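(* Consider the finite-sum problem $\min_{x\in\mathbb{R}^d} f(x)$, $f=\frac1n\sum_{i=1}^n f_i$, and suppose that Assumptions (A1)--(A5) of the context hold. Run the SpiderSQN algorithm described in the context with $q=|\xi_k|\equiv\sqrt n$ and constant step size $$\eta\equiv\frac{2\sigma_{\min}}{(1+\sqrt5)\,L\,\sigma_{\max}^2},$$ and let $x_\zeta$ be its output. Then, for any $\epsilon>0$, the output satisfies $\mathbb{E}\|\nabla f(x_\zeta)\|\le\epsilon$ provided that the number of iterations $K$ satisfies $$K\ge \mathcal{O}\Big(\frac{f(x_0)-f^*}{\epsilon^2}\Big).$$ Moreover, the total number of SFO calls (needed to achieve this) is at most in the order of $\mathcal{O}(n+n^{1/2}\epsilon^{-2})$.
   Context: Norms are Euclidean for vectors and spectral for matrices; $A\preceq B$ means that $B-A$ is positive semidefinite. Assumptions. (A1) $f^*:=\inf_{x\in\mathbb{R}^d} f(x)>-\infty$. (A2) Each $f_i:\mathbb{R}^d\to\mathbb{R}$ is $L$-smooth with $L>0$: $\|\nabla f_i(x)-\nabla f_i(y)\|\le L\|x-y\|$ for all $x,y$. (A3) Each $f_i$ is twice continuously differentiable and there is $\kappa>0$ with $\|\nabla^2 f_i(x)\|\le\kappa$ for all $x$ and $i$. (A4) There are constants $\sigma_{\min},\sigma_{\max}>0$ with $\sigma_{\min}I\preceq H_k\preceq\sigma_{\max}I$ for all $k$, where $H_k$ is the inverse Hessian approximation matrix used at iteration $k$. (A5) For $k\ge2$, $H_k$ depends only on $v_{k-1}$ and $\xi_k$, and $\mathbb{E}[H_kv_k\mid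 \xi_k,v_{k-1}]=H_kv_k$. SpiderSQN algorithm. Start at $x_0\in\mathbb{R}^d$. For $k=0,\dots,K-1$: if $k\equiv0 \pmod q$, set $v_k=\nabla f(x_k)$; otherwise draw a mini-batch $\xi_k$ of $|\xi_k|$ indices uniformly at random with replacement from $\{1,\dots,n\}$ and set $v_k=\nabla f_{\xi_k}(x_k)-\nabla f_{\xi_k}(x_{k-1})+v_{k-1}$, where $\nabla f_{\xi_k}(x)=\frac1{|\xi_k|}\sum_{i\in\xi_k}\nabla f_i(x)$. Compute $d_k=H_kv_k$ by SdLBFGS (below) and set $x_{k+1}=x_k-\eta d_k$. The output is $x_\zeta$ with $\zeta$ uniformly distributed on $\{1,\dots,K\}$. SdLBFGS (stochastic damped L-BFGS, memory size $m$, constant $\delta>0$). For $k\ge1$ put $s_{k-1}=x_k-x_{k-1}$, $\bar y_{k-1}=v_k-v_{k-1}$, $\gamma_k=\max\{\bar y_{k-1}^\top\bar y_{k-1}/(s_{k-1}^\top\bar y_{k-1}),\delta\}$, $H_{k,0}=\gamma_k^{-1}I$, $\sigma_{k-1}=s_{k-1}^\top H_{k,0}^{-1}s_{k-1}$, $\theta_{k-1}=\frac{0.75\sigma_{k-1}}{\sigma_{k-1}-s_{k-1}^\top\bar y_{k-1}}$ if $s_{k-1}^\top\bar y_{k-1}<0.25\sigma_{k-1}$ and $\theta_{k-1}=1$ otherwise, $\hat y_{k-1}=\theta_{k-1}\bar y_{k-1}+(1-\theta_{k-1})H_{k,0}^{-1}s_{k-1}$, $\rho_{k-1}=(s_{k-1}^\top\hat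 y_{k-1})^{-1}$. Starting from $H_{k,0}$, $H_k$ is obtained by applying, successively for the (at most $m$) most recent indices $j=k-m,\dots,k-1$ with $j\ge0$, the update $H\mapsto (I-\rho_js_j\hat y_j^\top)H(I-\rho_j\hat y_js_j^\top)+\rho_js_js_j^\top$. For $k=0$ there are no pairs and $H_0=H_{0,0}=\gamma_0^{-1}I$. An SFO (stochastic first-order oracle) call takes a sample index $i$ and a point $x$ and returns $(f_i(x),\nabla f_i(x))$; a full gradient costs $n$ calls. Integer rounding of $\sqrt n$ is suppressed. "$K\ge\mathcal{O}(A)$" means: there is a constant $C>0$ depending only on $L,\sigma_{\min},\sigma_{\max}$ such that $K\ge CA$ suffices. The SFO count refers to $K$ taken of this order; the hidden constant may depend on $L,\sigma_{\min},\sigma_{\max}$ and $f(x_0)-f^*$, but not on $n$ or $\epsilon$. *)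

theory Defs
  imports "HOL-Probability.Probability" "Jordan_Normal_Form.Matrix"
begin

unbundle no vec_syntax
unbundle no inner_syntax

text \<open>
  The constants hidden in the \<open>O\<close>-notation must not depend on the dimension \<open>d\<close>, so \<open>d\<close> has to be
  quantified inside the formula and cannot be a type. Vectors and matrices are therefore those of
  \<^theory>\<open>Jordan_Normal_Form.Matrix\<close>, with \<open>carrier_vec d\<close> as \<open>d\<close>-dimensional Euclidean space. As
  these types carry no norm or topology, the required calculus is given in epsilon-delta form.
\<close>

definition vnorm :: "real vec \<Rightarrow> real" where
  "vnorm x = sqrt (x \<bullet> x)"

definition spectral_norm :: "real mat \<Rightarrow> real" where
  "spectral_norm A = (SUP u\<in>{u \<in> carrier_vec (dim_col A). vnorm u \<le> 1}. vnorm (A *\<^sub>v u))"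

definition pos_semidef :: "nat \<Rightarrow> real mat \<Rightarrow> bool" where
  "pos_semidef d A \<longleftrightarrow>
     A \<in> carrier_mat d d \<and> A\<^sup>T = A \<and> (\<forall>u\<in>carrier_vec d. 0 \<le> u \<bullet> (A *\<^sub>v u))"

definition loewner_le :: "nat \<Rightarrow> real mat \<Rightarrow> real mat \<Rightarrow> bool" where
  "loewner_le d A B \<longleftrightarrow> pos_semidef d (B - A)"

definition outer :: "real vec \<Rightarrow> real vec \<Rightarrow> real mat" where
  "outer a b = mat (dim_vec a) (dim_vec b) (\<lambda>(i, j). a $ i * b $ j)"

text \<open>Frechet differentiability of \<open>g\<close> at \<open>x\<close> with gradient \<open>p\<close>.\<close>

definition has_grad :: "nat \<Rightarrow> (real vec \<Rightarrow> real) \<Rightarrow> real vec \<Rightarrow> real vec \<Rightarrow> bool" where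
  "has_grad d g p x \<longleftrightarrow> p \<in> carrier_vec d \<and>
     (\<forall>e>0. \<exists>r>0. \<forall>h\<in>carrier_vec d. vnorm h < r \<longrightarrow>
        \<bar>g (x + h) - g x - p \<bullet> h\<bar> \<le> e * vnorm h)"

definition grad :: "nat \<Rightarrow> (real vec \<Rightarrow> real) \<Rightarrow> real vec \<Rightarrow> real vec" where
  "grad d g x = (THE p. has_grad d g p x)"

text \<open>Frechet differentiability of the vector field \<open>G\<close> at \<open>x\<close> with Jacobian matrix \<open>A\<close>.\<close>

definition has_jacobian :: "nat \<Rightarrow> (real vec \<Rightarrow> real vec) \<Rightarrow> real mat \<Rightarrow> real vec \<Rightarrow> bool" where
  "has_jacobian d G A x \<longleftrightarrow> A \<in> carrier_mat d d \<and>
     (\<forall>e>0. \<exists>r>0. \<forall>h\<in>carrier_vec d. vnorm h < r \<longrightarrow>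
        vnorm (G (x + h) - G x - A *\<^sub>v h) \<le> e * vnorm h)"

definition hessian :: "nat \<Rightarrow> (real vec \<Rightarrow> real) \<Rightarrow> real vec \<Rightarrow> real mat" where
  "hessian d g x = (THE A. has_jacobian d (grad d g) A x)"

definition differentiable_everywhere :: "nat \<Rightarrow> (real vec \<Rightarrow> real) \<Rightarrow> bool" where
  "differentiable_everywhere d g \<longleftrightarrow> (\<forall>x\<in>carrier_vec d. \<exists>p. has_grad d g p x)"

definition L_smooth :: "nat \<Rightarrow> real \<Rightarrow> (real vec \<Rightarrow> real) \<Rightarrow> bool" where
  "L_smooth d L g \<longleftrightarrow> differentiable_everywhere d g \<and>
     (\<forall>x\<in>carrier_vec d. \<forall>y\<in>carrier_vec d. vnorm (grad d g x - grad d g y) \<le> L * vnorm (x - y))"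

definition twice_cont_diff :: "nat \<Rightarrow> (real vec \<Rightarrow> real) \<Rightarrow> bool" where
  "twice_cont_diff d g \<longleftrightarrow> differentiable_everywhere d g \<and>
     (\<forall>x\<in>carrier_vec d. \<exists>A. has_jacobian d (grad d g) A x) \<and>
     (\<forall>x\<in>carrier_vec d. \<forall>e>0. \<exists>r>0. \<forall>y\<in>carrier_vec d. vnorm (y - x) < r \<longrightarrow>
        spectral_norm (hessian d g y - hessian d g x) < e)"

definition objective :: "nat \<Rightarrow> (nat \<Rightarrow> real vec \<Rightarrow> real) \<Rightarrow> real vec \<Rightarrow> real" where
  "objective n f x = (\<Sum>i = 1..n. f i x) / real n"

definition batch_grad ::
    "nat \<Rightarrow> (nat \<Rightarrow> real vec \<Rightarrow> real) \<Rightarrow> nat list \<Rightarrow> real vec \<Rightarrow> real vec" where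
  "batch_grad d f is x = vec d (\<lambda>j. (\<Sum>i\<leftarrow>is. grad d (f i) x $ j) / real (length is))"

text \<open>
  All quantities are functions of the sequences of iterates \<open>x\<close> and gradient estimates \<open>v\<close>; the
  matrix \<open>lbfgs_H \<dots> x v k\<close> reads only their entries with index at most \<open>k\<close>. The convention
  \<open>a / 0 = 0\<close> applies to the quotients: if \<open>s\<^sup>T y = 0\<close>, the scaling \<open>\<gamma>\<close> becomes \<open>\<delta>\<close>, and a pair with
  \<open>s = 0\<close> leaves the matrix unchanged.
\<close>

definition lbfgs_s :: "(nat \<Rightarrow> real vec) \<Rightarrow> nat \<Rightarrow> real vec" where
  "lbfgs_s x j = x (Suc j) - x j"

definition lbfgs_ybar :: "(nat \<Rightarrow> real vec) \<Rightarrow> nat \<Rightarrow> real vec" where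
  "lbfgs_ybar v j = v (Suc j) - v j"

fun lbfgs_gamma ::
    "real \<Rightarrow> real \<Rightarrow> (nat \<Rightarrow> real vec) \<Rightarrow> (nat \<Rightarrow> real vec) \<Rightarrow> nat \<Rightarrow> real" where
  "lbfgs_gamma \<delta> \<gamma>0 x v 0 = \<gamma>0"
| "lbfgs_gamma \<delta> \<gamma>0 x v (Suc j) =
     max ((lbfgs_ybar v j \<bullet> lbfgs_ybar v j) / (lbfgs_s x j \<bullet> lbfgs_ybar v j)) \<delta>"

definition lbfgs_H0 ::
    "nat \<Rightarrow> real \<Rightarrow> real \<Rightarrow> (nat \<Rightarrow> real vec) \<Rightarrow> (nat \<Rightarrow> real vec) \<Rightarrow> nat \<Rightarrow> real mat" where
  "lbfgs_H0 d \<delta> \<gamma>0 x v k = (1 / lbfgs_gamma \<delta> \<gamma>0 x v k) \<cdot>\<^sub>m 1\<^sub>m d"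

text \<open>The inverse of \<^const>\<open>lbfgs_H0\<close>; the scaling \<open>\<gamma>\<close> is positive since \<open>\<delta>\<close> and \<open>\<gamma>0\<close> are.\<close>

definition lbfgs_H0_inv ::
    "nat \<Rightarrow> real \<Rightarrow> real \<Rightarrow> (nat \<Rightarrow> real vec) \<Rightarrow> (nat \<Rightarrow> real vec) \<Rightarrow> nat \<Rightarrow> real mat" where
  "lbfgs_H0_inv d \<delta> \<gamma>0 x v k = lbfgs_gamma \<delta> \<gamma>0 x v k \<cdot>\<^sub>m 1\<^sub>m d"

definition lbfgs_sigma ::
    "nat \<Rightarrow> real \<Rightarrow> real \<Rightarrow> (nat \<Rightarrow> real vec) \<Rightarrow> (nat \<Rightarrow> real vec) \<Rightarrow> nat \<Rightarrow> real" where
  "lbfgs_sigma d \<delta> \<gamma>0 x v j =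
     lbfgs_s x j \<bullet> (lbfgs_H0_inv d \<delta> \<gamma>0 x v (Suc j) *\<^sub>v lbfgs_s x j)"

definition lbfgs_theta ::
    "nat \<Rightarrow> real \<Rightarrow> real \<Rightarrow> (nat \<Rightarrow> real vec) \<Rightarrow> (nat \<Rightarrow> real vec) \<Rightarrow> nat \<Rightarrow> real" where
  "lbfgs_theta d \<delta> \<gamma>0 x v j =
     (let \<sigma> = lbfgs_sigma d \<delta> \<gamma>0 x v j; sy = lbfgs_s x j \<bullet> lbfgs_ybar v j
      in if sy < 0.25 * \<sigma> then 0.75 * \<sigma> / (\<sigma> - sy) else 1)"

definition lbfgs_yhat ::
    "nat \<Rightarrow> real \<Rightarrow> real \<Rightarrow> (nat \<Rightarrow> real vec) \<Rightarrow> (nat \<Rightarrow> real vec) \<Rightarrow> nat \<Rightarrow> real vec" where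
  "lbfgs_yhat d \<delta> \<gamma>0 x v j =
     (let \<theta> = lbfgs_theta d \<delta> \<gamma>0 x v j
      in \<theta> \<cdot>\<^sub>v lbfgs_ybar v j
         + (1 - \<theta>) \<cdot>\<^sub>v (lbfgs_H0_inv d \<delta> \<gamma>0 x v (Suc j) *\<^sub>v lbfgs_s x j))"

definition lbfgs_update ::
    "nat \<Rightarrow> real \<Rightarrow> real \<Rightarrow> (nat \<Rightarrow> real vec) \<Rightarrow> (nat \<Rightarrow> real vec) \<Rightarrow> nat \<Rightarrow> real mat \<Rightarrow> real mat"
  where
  "lbfgs_update d \<delta> \<gamma>0 x v j H =
     (let s = lbfgs_s x j; y = lbfgs_yhat d \<delta> \<gamma>0 x v j; \<rho> = 1 / (s \<bullet> y)
      in (1\<^sub>m d - \<rho> \<cdot>\<^sub>m outer s y) * H * (1\<^sub>m d - \<rho> \<cdot>\<^sub>m outer y s) + \<rho> \<cdot>\<^sub>m outer s s)"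

text \<open>
  Truncated subtraction makes \<open>[k - m..<k]\<close> the indices \<open>k - m, \<dots>, k - 1\<close> that are nonnegative;
  \<^const>\<open>fold\<close> applies their updates in increasing order.
\<close>

definition lbfgs_H ::
    "nat \<Rightarrow> nat \<Rightarrow> real \<Rightarrow> real \<Rightarrow> (nat \<Rightarrow> real vec) \<Rightarrow> (nat \<Rightarrow> real vec) \<Rightarrow> nat \<Rightarrow> real mat" where
  "lbfgs_H d m \<delta> \<gamma>0 x v k =
     fold (lbfgs_update d \<delta> \<gamma>0 x v) [k - m..<k] (lbfgs_H0 d \<delta> \<gamma>0 x v k)"

text \<open>
  The joint law of the mini-batches of the first \<open>K\<close> iterations: independent over \<open>k\<close>, and each a
  list of \<open>b\<close> indices drawn uniformly with replacement. The batch is empty at iterations that use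
  the full gradient.
\<close>

definition batches_pmf :: "nat \<Rightarrow> nat \<Rightarrow> nat \<Rightarrow> nat \<Rightarrow> (nat \<Rightarrow> nat list) pmf" where
  "batches_pmf n q b K = Pi_pmf {..<K} []
     (\<lambda>k. if q dvd k then return_pmf [] else replicate_pmf b (pmf_of_set {1..n}))"

text \<open>
  \<open>x 0, \<dots>, x K\<close> and \<open>v 0, \<dots>, v (K - 1)\<close> are the iterates and gradient estimates produced with
  step size \<open>\<eta>\<close> and mini-batches \<open>\<xi>\<close>. The equations determine them uniquely.
\<close>

definition spidersqn_run ::
    "nat \<Rightarrow> nat \<Rightarrow> (nat \<Rightarrow> real vec \<Rightarrow> real) \<Rightarrow> nat \<Rightarrow> real \<Rightarrow> nat \<Rightarrow> real \<Rightarrow> real \<Rightarrow> nat \<Rightarrow> real vec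
     \<Rightarrow> (nat \<Rightarrow> nat list) \<Rightarrow> (nat \<Rightarrow> real vec) \<Rightarrow> (nat \<Rightarrow> real vec) \<Rightarrow> bool" where
  "spidersqn_run d n f q \<eta> m \<delta> \<gamma>0 K x0 \<xi> x v \<longleftrightarrow>
     x 0 = x0 \<and>
     (\<forall>k<K.
        v k = (if q dvd k then grad d (objective n f) (x k)
               else batch_grad d f (\<xi> k) (x k) - batch_grad d f (\<xi> k) (x (k - 1)) + v (k - 1)) \<and>
        x (Suc k) = x k - \<eta> \<cdot>\<^sub>v (lbfgs_H d m \<delta> \<gamma>0 x v k *\<^sub>v v k))"

text \<open>A mini-batch step evaluates every sampled component at \<open>x k\<close> and at \<open>x (k - 1)\<close>.\<close>

definition sfo_calls :: "nat \<Rightarrow> nat \<Rightarrow> nat \<Rightarrow> (nat \<Rightarrow> nat list) \<Rightarrow> nat" where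
  "sfo_calls n q K \<xi> = (\<Sum>k<K. if q dvd k then n else 2 * length (\<xi> k))"

text \<open>
  \<open>H k\<close> depends only on \<open>v (k - 1)\<close> and \<open>\<xi> k\<close>, and \<open>E[H k v k | \<xi> k, v (k - 1)] = H k v k\<close> almost
  surely, with the conditional expectation taken componentwise. The conditioning sigma-algebra is
  generated from count space on the values; since the law is finitely supported, it agrees with
  the one generated from the Borel sets up to null sets.
\<close>

definition H_conditionally_determined ::
    "nat \<Rightarrow> nat \<Rightarrow> (nat \<Rightarrow> nat list) pmf
     \<Rightarrow> ((nat \<Rightarrow> nat list) \<Rightarrow> nat \<Rightarrow> real mat) \<Rightarrow> ((nat \<Rightarrow> nat list) \<Rightarrow> nat \<Rightarrow> real vec) \<Rightarrow> bool" where
  "H_conditionally_determined d K P H v \<longleftrightarrow>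
     (\<forall>k. 2 \<le> k \<and> k < K \<longrightarrow>
        (\<exists>\<phi>. \<forall>\<xi>\<in>set_pmf P. H \<xi> k = \<phi> (v \<xi> (k - 1)) (\<xi> k)) \<and>
        (\<forall>i<d. AE \<xi> in measure_pmf P.
           real_cond_exp (measure_pmf P)
             (vimage_algebra UNIV (\<lambda>\<xi>. (\<xi> k, v \<xi> (k - 1))) (count_space UNIV))
             (\<lambda>\<xi>. (H \<xi> k *\<^sub>v v \<xi> k) $ i) \<xi>
           = (H \<xi> k *\<^sub>v v \<xi> k) $ i))"

end

theory Submission
  imports Defs
begin

text \<open>
  Let \<open>e\<^sub>k = v\<^sub>k - \<nabla>f(x\<^sub>k)\<close>. The matrix \<open>H\<^sub>k\<close> only affects \<open>x\<^sub>k\<^sub>+\<^sub>1\<close>, so \<open>\<xi>\<^sub>k\<close> is independent of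
  \<open>x\<^sub>k, x\<^sub>k\<^sub>-\<^sub>1, v\<^sub>k\<^sub>-\<^sub>1\<close> and \<open>e\<^sub>k\<close> is a martingale within an epoch: its second moment grows by at most
  \<open>(L\<^sup>2 / q) E \<parallel>x\<^sub>k - x\<^sub>k\<^sub>-\<^sub>1\<parallel>\<^sup>2\<close> per step. An epoch has \<open>q\<close> steps, which cancels the batch size \<open>q\<close>
  whatever the rounding of \<open>\<surd>n\<close>, and gives
  \<open>\<Sum> E \<parallel>e\<^sub>k\<parallel>\<^sup>2 \<le> (L \<eta> \<sigma>\<^sub>m\<^sub>a\<^sub>x)\<^sup>2 \<Sum> E \<parallel>v\<^sub>k\<parallel>\<^sup>2\<close>. The descent lemma with Young's inequality of weight \<open>L\<close>
  bounds \<open>\<eta> (\<sigma>\<^sub>m\<^sub>i\<^sub>n - 3/2 L \<eta> \<sigma>\<^sub>m\<^sub>a\<^sub>x\<^sup>2) \<Sum> E \<parallel>v\<^sub>k\<parallel>\<^sup>2\<close> by \<open>f(x\<^sub>0) - f\<^sup>*\<close>. Finally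
  \<open>\<parallel>\<nabla>f(x\<^sub>k\<^sub>+\<^sub>1)\<parallel> \<le> \<parallel>e\<^sub>k\<parallel> + (1 + L \<eta> \<sigma>\<^sub>m\<^sub>a\<^sub>x) \<parallel>v\<^sub>k\<parallel>\<close> covers all output indices \<open>1, \<dots>, K\<close>, including
  \<open>K\<close>, for which no estimate \<open>v\<^sub>K\<close> exists.
\<close>

subsection \<open>Euclidean norm\<close>

text \<open>Through this identity the Cauchy-Schwarz and triangle inequalities of
  \<open>L2_set\<close> become available for \<open>vnorm\<close>.\<close>

lemma vnorm_eq_L2_set:
  assumes "x \<in> carrier_vec d"
  shows "vnorm x = L2_set (($) x) {..<d}"
  using assms unfolding vnorm_def L2_set_def scalar_prod_def
  by (simp add: power2_eq_square atLeast0LessThan carrier_vecD)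

lemma vnorm_nonneg [simp]: "0 \<le> vnorm x"
  unfolding vnorm_def scalar_prod_def by (intro real_sqrt_ge_zero sum_nonneg) simp

lemma vnorm_square: "(vnorm x)\<^sup>2 = x \<bullet> x"
  unfolding vnorm_def by (simp add: scalar_prod_def sum_nonneg)

lemma vnorm_square_sum:
  assumes "x \<in> carrier_vec d"
  shows "(vnorm x)\<^sup>2 = (\<Sum>j<d. (x $ j)\<^sup>2)"
  using vnorm_eq_L2_set[OF assms] by (simp add: L2_set_def sum_nonneg)

lemma vnorm_zero [simp]: "vnorm (0\<^sub>v d) = 0"
  by (simp add: vnorm_def)

lemma vnorm_eq_0D:
  assumes "x \<in> carrier_vec d" "vnorm x = 0"
  shows "x = 0\<^sub>v d"
proof (rule eq_vecI)
  have "(\<Sum>j<d. (x $ j)\<^sup>2) = 0"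
    using vnorm_square_sum[OF assms(1)] assms(2) by simp
  then show "x $ j = 0\<^sub>v d $ j" if "j < dim_vec (0\<^sub>v d)" for j
    using that by (simp add: sum_nonneg_eq_0_iff)
qed (use assms in auto)

lemma abs_scalar_prod_le:
  assumes "x \<in> carrier_vec d" "y \<in> carrier_vec d"
  shows "\<bar>x \<bullet> y\<bar> \<le> vnorm x * vnorm y"
proof -
  have "\<bar>x \<bullet> y\<bar> \<le> (\<Sum>i<d. \<bar>x $ i\<bar> * \<bar>y $ i\<bar>)"
    unfolding scalar_prod_def
    using sum_abs[of "\<lambda>i. x $ i * y $ i" "{..<d}"] assms by (simp add: abs_mult atLeast0LessThan)
  also have "\<dots> \<le> vnorm x * vnorm y"
    using L2_set_mult_ineq[of "($) x" "($) y" "{..<d}"] assms by (simp add: vnorm_eq_L2_set)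
  finally show ?thesis .
qed

lemma vnorm_triangle:
  assumes "x \<in> carrier_vec d" "y \<in> carrier_vec d"
  shows "vnorm (x + y) \<le> vnorm x + vnorm y"
proof -
  have "L2_set (($) (x + y)) {..<d} = L2_set (\<lambda>i. x $ i + y $ i) {..<d}"
    using assms by (intro L2_set_cong) auto
  then show ?thesis
    using L2_set_triangle_ineq[of "($) x" "($) y" "{..<d}"] assms
      vnorm_eq_L2_set[of "x + y" d] by (simp add: vnorm_eq_L2_set)
qed

lemma vnorm_smult: "vnorm (c \<cdot>\<^sub>v x) = \<bar>c\<bar> * vnorm x"
  by (simp add: vnorm_def real_sqrt_mult mult.assoc[symmetric] power2_eq_square[symmetric])

lemma vnorm_minus_commute:
  assumes "x \<in> carrier_vec d" "y \<in> carrier_vec d"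
  shows "vnorm (x - y) = vnorm (y - x)"
proof -
  have "x - y = (-1) \<cdot>\<^sub>v (y - x)" using assms by auto
  then show ?thesis by (simp add: vnorm_smult)
qed

lemma vnorm_minus_le:
  assumes "x \<in> carrier_vec d" "y \<in> carrier_vec d"
  shows "vnorm x \<le> vnorm y + vnorm (x - y)"
proof -
  have "x = y + (x - y)" using assms by auto
  then show ?thesis using vnorm_triangle[of y d "x - y"] assms by simp
qed

subsection \<open>Gradients\<close>

lemma has_gradE:
  assumes "has_grad d g p x" "e > 0"
  obtains r where "r > 0" "\<And>h. h \<in> carrier_vec d \<Longrightarrow> vnorm h < r \<Longrightarrow>
      \<bar>g (x + h) - g x - p \<bullet> h\<bar> \<le> e * vnorm h"
  using assms unfolding has_grad_def by blast

text \<open>Both expansions are tested on a short multiple of \<open>u = p - p'\<close>: there the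
  two linear parts differ by \<open>t\<close> times the squared norm of \<open>u\<close>, which the
  error bounds keep below \<open>e * t\<close> times the norm. Uniqueness makes the description
  operator in \<open>grad\<close> meaningful.\<close>

lemma has_grad_unique:
  assumes "has_grad d g p x" "has_grad d g p' x"
  shows "p = p'"
proof -
  have c: "p \<in> carrier_vec d" "p' \<in> carrier_vec d"
    using assms by (auto simp: has_grad_def)
  define u where "u = p - p'"
  have u: "u \<in> carrier_vec d" using c by (auto simp: u_def)
  have "vnorm u \<le> 0"
  proof (rule field_le_epsilon)
    fix e :: real assume e: "e > 0"
    obtain r where r: "r > 0" "\<And>h. h \<in> carrier_vec d \<Longrightarrow> vnorm h < r \<Longrightarrow>
        \<bar>g (x + h) - g x - p \<bullet> h\<bar> \<le> e / 2 * vnorm h"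
      using has_gradE[OF assms(1) half_gt_zero[OF e]] by blast
    obtain r' where r': "r' > 0" "\<And>h. h \<in> carrier_vec d \<Longrightarrow> vnorm h < r' \<Longrightarrow>
        \<bar>g (x + h) - g x - p' \<bullet> h\<bar> \<le> e / 2 * vnorm h"
      using has_gradE[OF assms(2) half_gt_zero[OF e]] by blast
    \<comment> \<open>Small enough for \<open>t\<close> times \<open>u\<close> to lie within both
      radii; the \<open>+ 1\<close> keeps the denominator positive even if \<open>u\<close>
      vanishes.\<close>
    define t where "t = min r r' / (2 * (vnorm u + 1))"
    have np: "vnorm u + 1 > 0" by (rule add_nonneg_pos) auto
    have t: "t > 0" using r(1) r'(1) np by (simp add: t_def)
    have "t * vnorm u < min r r'"
    proof -
      have "t * vnorm u \<le> t * (vnorm u + 1)" using t by simp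
      also have "\<dots> = min r r' / 2" using np unfolding t_def by (simp del: distrib_left_numeral distrib_right_numeral)
      also have "\<dots> < min r r'" using r(1) r'(1) by (simp add: min_def)
      finally show ?thesis .
    qed
    then have h: "vnorm (t \<cdot>\<^sub>v u) < r" "vnorm (t \<cdot>\<^sub>v u) < r'"
      using t by (auto simp: vnorm_smult)
    have "\<bar>p \<bullet> (t \<cdot>\<^sub>v u) - p' \<bullet> (t \<cdot>\<^sub>v u)\<bar> \<le> e * vnorm (t \<cdot>\<^sub>v u)"
      using r(2)[OF _ h(1)] r'(2)[OF _ h(2)] u by (simp add: abs_if split: if_splits)
    moreover have "p \<bullet> (t \<cdot>\<^sub>v u) - p' \<bullet> (t \<cdot>\<^sub>v u) = t * (vnorm u)\<^sup>2"
      using c u minus_scalar_prod_distrib[of p d p' u]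
      by (simp add: vnorm_square u_def[symmetric] right_diff_distrib[symmetric])
    ultimately have "t * vnorm u * vnorm u \<le> t * vnorm u * e"
      using t by (simp add: vnorm_smult power2_eq_square algebra_simps)
    then show "vnorm u \<le> 0 + e"
      using t e vnorm_nonneg[of u] by (cases "vnorm u = 0") (auto simp: mult_le_cancel_left)
  qed
  then have "p - p' = 0\<^sub>v d" using vnorm_eq_0D[OF u] by (simp add: u_def order_antisym)
  then have e: "(p - p') $ i = 0\<^sub>v d $ i" for i by simp
  show ?thesis
  proof (rule eq_vecI)
    show "p $ i = p' $ i" if "i < dim_vec p'" for i
      using e[of i] that c by simp
  qed (use c in auto)
qed

lemma grad_eqI:
  assumes "has_grad d g p x"
  shows "grad d g x = p"
  unfolding grad_def using assms has_grad_unique by blast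

lemma has_grad_grad:
  assumes "differentiable_everywhere d g" "x \<in> carrier_vec d"
  shows "has_grad d g (grad d g x) x"
  using assms grad_eqI unfolding differentiable_everywhere_def by metis

lemma grad_carrier:
  assumes "differentiable_everywhere d g" "x \<in> carrier_vec d"
  shows "grad d g x \<in> carrier_vec d"
  using has_grad_grad[OF assms] by (simp add: has_grad_def)

lemma has_grad_zero: "has_grad d (\<lambda>x. 0) (0\<^sub>v d) x"
  unfolding has_grad_def by (auto intro!: exI[of _ 1])

lemma has_grad_add:
  assumes "has_grad d g p x" "has_grad d g' p' x"
  shows "has_grad d (\<lambda>x. g x + g' x) (p + p') x"
  unfolding has_grad_def
proof (intro conjI allI impI)
  have c: "p \<in> carrier_vec d" "p' \<in> carrier_vec d"
    using assms by (auto simp: has_grad_def)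
  then show "p + p' \<in> carrier_vec d" by simp
  fix e :: real assume e: "e > 0"
  obtain r where r: "r > 0" "\<And>h. h \<in> carrier_vec d \<Longrightarrow> vnorm h < r \<Longrightarrow>
      \<bar>g (x + h) - g x - p \<bullet> h\<bar> \<le> e / 2 * vnorm h"
    using has_gradE[OF assms(1) half_gt_zero[OF e]] by blast
  obtain r' where r': "r' > 0" "\<And>h. h \<in> carrier_vec d \<Longrightarrow> vnorm h < r' \<Longrightarrow>
      \<bar>g' (x + h) - g' x - p' \<bullet> h\<bar> \<le> e / 2 * vnorm h"
    using has_gradE[OF assms(2) half_gt_zero[OF e]] by blast
  show "\<exists>r>0. \<forall>h\<in>carrier_vec d. vnorm h < r \<longrightarrow>
      \<bar>g (x + h) + g' (x + h) - (g x + g' x) - (p + p') \<bullet> h\<bar> \<le> e * vnorm h"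
  proof (intro exI[of _ "min r r'"] conjI ballI impI)
    fix h assume h: "h \<in> carrier_vec d" "vnorm h < min r r'"
    have "(p + p') \<bullet> h = p \<bullet> h + p' \<bullet> h"
      using c h by (simp add: add_scalar_prod_distrib)
    then show "\<bar>g (x + h) + g' (x + h) - (g x + g' x) - (p + p') \<bullet> h\<bar> \<le> e * vnorm h"
      using r(2)[of h] r'(2)[of h] h by (simp add: abs_if split: if_splits)
  qed (use r r' in simp)
qed

lemma has_grad_divide:
  assumes "has_grad d g p x" "c > 0"
  shows "has_grad d (\<lambda>x. g x / c) ((1 / c) \<cdot>\<^sub>v p) x"
  unfolding has_grad_def
proof (intro conjI allI impI)
  have p: "p \<in> carrier_vec d"
    using assms by (auto simp: has_grad_def)
  then show "(1 / c) \<cdot>\<^sub>v p \<in> carrier_vec d" by simp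
  fix e :: real assume e: "e > 0"
  obtain r where r: "r > 0" "\<And>h. h \<in> carrier_vec d \<Longrightarrow> vnorm h < r \<Longrightarrow>
      \<bar>g (x + h) - g x - p \<bullet> h\<bar> \<le> (e * c) * vnorm h"
    using has_gradE[OF assms(1) mult_pos_pos[OF e assms(2)]] by blast
  show "\<exists>r>0. \<forall>h\<in>carrier_vec d. vnorm h < r \<longrightarrow>
      \<bar>g (x + h) / c - g x / c - ((1 / c) \<cdot>\<^sub>v p) \<bullet> h\<bar> \<le> e * vnorm h"
  proof (intro exI[of _ r] conjI ballI impI r(1))
    fix h assume h: "h \<in> carrier_vec d" "vnorm h < r"
    have "g (x + h) / c - g x / c - ((1 / c) \<cdot>\<^sub>v p) \<bullet> h = (g (x + h) - g x - p \<bullet> h) / c"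
      using p h by (simp add: diff_divide_distrib)
    then show "\<bar>g (x + h) / c - g x / c - ((1 / c) \<cdot>\<^sub>v p) \<bullet> h\<bar> \<le> e * vnorm h"
      using r(2)[OF h] assms(2) by (simp add: abs_divide field_simps)
  qed
qed

lemma has_grad_sum:
  assumes "finite A" "\<And>i. i \<in> A \<Longrightarrow> has_grad d (f i) (p i) x"
  shows "has_grad d (\<lambda>x. \<Sum>i\<in>A. f i x) (vec d (\<lambda>j. \<Sum>i\<in>A. p i $ j)) x"
  using assms
proof (induction A rule: finite_induct)
  case empty
  have "vec d (\<lambda>j. 0) = (0\<^sub>v d :: real vec)" by auto
  then show ?case using has_grad_zero by simp
next
  case (insert a A)
  have "p a \<in> carrier_vec d" using insert.prems[of a] by (simp add: has_grad_def)
  then have "vec d (\<lambda>j. \<Sum>i\<in>insert a A. p i $ j) = p a + vec d (\<lambda>j. \<Sum>i\<in>A. p i $ j)"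
    using insert.hyps by (intro eq_vecI) auto
  then show ?case
    using has_grad_add[OF insert.prems[of a] insert.IH] insert by simp
qed

section \<open>Gradient and smoothness of the averaged objective\<close>

lemma has_grad_objective:
  assumes "n \<ge> 1" "x \<in> carrier_vec d"
    and "\<And>i. i \<in> {1..n} \<Longrightarrow> differentiable_everywhere d (f i)"
  shows "has_grad d (objective n f) (vec d (\<lambda>j. (\<Sum>i=1..n. grad d (f i) x $ j) / real n)) x"
proof -
  have eq: "vec d (\<lambda>j. (\<Sum>i=1..n. grad d (f i) x $ j) / real n)
      = (1 / real n) \<cdot>\<^sub>v vec d (\<lambda>j. \<Sum>i=1..n. grad d (f i) x $ j)"
    by auto
  show ?thesis
    unfolding objective_def[abs_def] eq
    using assms by (intro has_grad_divide has_grad_sum has_grad_grad) auto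
qed

text \<open>In coordinates the full gradient has the same shape as \<open>batch_grad\<close>, so
  that the two can be subtracted and averaged as real numbers.\<close>

lemma grad_objective_index:
  assumes "n \<ge> 1" "x \<in> carrier_vec d" "j < d"
    and "\<And>i. i \<in> {1..n} \<Longrightarrow> differentiable_everywhere d (f i)"
  shows "grad d (objective n f) x $ j = (\<Sum>i=1..n. grad d (f i) x $ j) / real n"
  using grad_eqI[OF has_grad_objective[of n x d f]] assms by simp

text \<open>With \<open>w\<close> the change of the averaged gradient, the scalar product of
  \<open>w\<close> with itself is the average of its products with the changes \<open>a i\<close>.
  Cauchy-Schwarz bounds each of these, and one factor \<open>vnorm w\<close> cancels.\<close>

lemma L_smooth_objective:
  assumes "n \<ge> 1" "L \<ge> 0" "\<And>i. i \<in> {1..n} \<Longrightarrow> L_smooth d L (f i)"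
  shows "L_smooth d L (objective n f)"
  unfolding L_smooth_def
proof (intro conjI ballI)
  have diff: "\<And>i. i \<in> {1..n} \<Longrightarrow> differentiable_everywhere d (f i)"
    using assms(3) by (auto simp: L_smooth_def)
  then show D: "differentiable_everywhere d (objective n f)"
    using has_grad_objective[OF assms(1)] unfolding differentiable_everywhere_def[of d "objective n f"]
    by blast
  fix x y :: "real vec" assume xy: "x \<in> carrier_vec d" "y \<in> carrier_vec d"
  define a where "a i = grad d (f i) x - grad d (f i) y" for i
  have a: "a i \<in> carrier_vec d" if "i \<in> {1..n}" for i
    using grad_carrier[OF diff[OF that]] xy by (simp add: a_def)
  define w where "w = grad d (objective n f) x - grad d (objective n f) y"
  have w: "w \<in> carrier_vec d" using grad_carrier[OF D] xy by (simp add: w_def)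
  have wj: "w $ j = (\<Sum>i=1..n. a i $ j) / real n" if "j < d" for j
  proof -
    have "w $ j = grad d (objective n f) x $ j - grad d (objective n f) y $ j"
      using that carrier_vecD[OF grad_carrier[OF D xy(2)]] by (simp add: w_def)
    also have "\<dots> = (\<Sum>i=1..n. grad d (f i) x $ j - grad d (f i) y $ j) / real n"
      using grad_objective_index[of n x d j f, OF assms(1) xy(1) that diff]
        grad_objective_index[of n y d j f, OF assms(1) xy(2) that diff]
      by (simp add: sum_subtractf diff_divide_distrib)
    also have "\<dots> = (\<Sum>i=1..n. a i $ j) / real n"
      using that carrier_vecD[OF grad_carrier[OF diff xy(2)]] by (simp add: a_def)
    finally show ?thesis .
  qed
  have "vnorm w * vnorm w = (\<Sum>j<d. w $ j * w $ j)"
    using vnorm_square_sum[OF w] by (simp add: power2_eq_square)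
  also have "\<dots> = (\<Sum>j<d. \<Sum>i=1..n. w $ j * a i $ j) / real n"
    using wj by (simp add: sum_divide_distrib sum_distrib_left)
  also have "\<dots> = (\<Sum>i=1..n. w \<bullet> a i) / real n"
    by (subst sum.swap)
      (intro arg_cong[of _ _ "\<lambda>t. t / real n"] sum.cong refl,
       simp add: scalar_prod_def atLeast0LessThan carrier_vecD[OF a])
  also have "\<dots> \<le> (\<Sum>i=1..n. vnorm w * (L * vnorm (x - y))) / real n"
  proof (intro divide_right_mono sum_mono)
    fix i assume i: "i \<in> {1..n}"
    have "w \<bullet> a i \<le> vnorm w * vnorm (a i)" using abs_scalar_prod_le[OF w a[OF i]] by simp
    also have "\<dots> \<le> vnorm w * (L * vnorm (x - y))"
      using assms(3)[OF i] xy by (intro mult_left_mono) (auto simp: L_smooth_def a_def)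
    finally show "w \<bullet> a i \<le> vnorm w * (L * vnorm (x - y))" .
  qed simp
  also have "\<dots> = vnorm w * (L * vnorm (x - y))" using assms(1) by simp
  finally show "vnorm w \<le> L * vnorm (x - y)"
    using vnorm_nonneg[of w] assms(2) by (cases "vnorm w = 0") (auto simp: mult_le_cancel_left)
qed

section \<open>Restriction to lines and the descent lemma\<close>

text \<open>Turns the epsilon-delta gradient into a derivative of a real function of
  \<open>t\<close>, to which the monotonicity criterion by the sign of the derivative
  applies.\<close>

lemma has_grad_line_derivative:
  assumes "has_grad d g p (x + t \<cdot>\<^sub>v h)" "x \<in> carrier_vec d" "h \<in> carrier_vec d"
  shows "((\<lambda>t. g (x + t \<cdot>\<^sub>v h)) has_real_derivative p \<bullet> h) (at t)"
  unfolding has_field_derivative_def has_derivative_at_alt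
proof (intro conjI allI impI bounded_linear_mult_right)
  fix e :: real assume e: "e > 0"
  have p: "p \<in> carrier_vec d" using assms(1) by (simp add: has_grad_def)
  \<comment> \<open>The \<open>+ 1\<close> makes the divisor positive even for
    \<open>h = 0\<close>.\<close>
  define N where "N = vnorm h + 1"
  have N: "N > 0" unfolding N_def by (rule add_nonneg_pos) auto
  obtain r where r: "r > 0" "\<And>k. k \<in> carrier_vec d \<Longrightarrow> vnorm k < r \<Longrightarrow>
      \<bar>g ((x + t \<cdot>\<^sub>v h) + k) - g (x + t \<cdot>\<^sub>v h) - p \<bullet> k\<bar> \<le> e / N * vnorm k"
    using has_gradE[OF assms(1) divide_pos_pos[OF e N]] by blast
  show "\<exists>\<delta>>0. \<forall>y. norm (y - t) < \<delta> \<longrightarrow>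
      norm (g (x + y \<cdot>\<^sub>v h) - g (x + t \<cdot>\<^sub>v h) - p \<bullet> h * (y - t)) \<le> e * norm (y - t)"
  proof (intro exI[of _ "r / N"] conjI allI impI)
    show "r / N > 0" using r N by simp
    fix y assume y: "norm (y - t) < r / N"
    define k where "k = (y - t) \<cdot>\<^sub>v h"
    have k: "k \<in> carrier_vec d" using assms by (simp add: k_def)
    have nk: "vnorm k \<le> \<bar>y - t\<bar> * N"
      by (auto simp: k_def vnorm_smult N_def intro: mult_left_mono)
    moreover have "\<bar>y - t\<bar> * N < r" using y N by (simp add: field_simps)
    ultimately have "vnorm k < r" by simp
    note r(2)[OF k this]
    moreover have "(x + t \<cdot>\<^sub>v h) + k = x + y \<cdot>\<^sub>v h"
      using assms by (auto simp: k_def algebra_simps)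
    moreover have "p \<bullet> k = p \<bullet> h * (y - t)" using p assms by (simp add: k_def)
    moreover have "e / N * vnorm k \<le> e / N * (\<bar>y - t\<bar> * N)"
      using nk e N by (intro mult_left_mono) auto
    ultimately show "norm (g (x + y \<cdot>\<^sub>v h) - g (x + t \<cdot>\<^sub>v h) - p \<bullet> h * (y - t)) \<le> e * norm (y - t)"
      using N by simp
  qed
qed

lemma L_smooth_descent:
  assumes "L_smooth d L g" "x \<in> carrier_vec d" "h \<in> carrier_vec d"
  shows "g (x + h) \<le> g x + grad d g x \<bullet> h + L / 2 * (vnorm h)\<^sup>2"
proof -
  have D: "differentiable_everywhere d g" using assms(1) by (simp add: L_smooth_def)
  \<comment> \<open>The claim is exactly \<open>\<psi> 1 \<le> \<psi> 0\<close>. The term quadratic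
    in \<open>t\<close> is chosen so that its derivative dominates the growth of the directional
    derivative, which smoothness bounds by \<open>L * t\<close> times the squared norm of
    \<open>h\<close>.\<close>
  define \<psi> where "\<psi> t = g (x + t \<cdot>\<^sub>v h) - t * (grad d g x \<bullet> h) - L / 2 * (vnorm h)\<^sup>2 * t\<^sup>2" for t
  have "\<psi> 1 \<le> \<psi> 0"
  proof (rule DERIV_nonpos_imp_nonincreasing[of 0 1 \<psi>])
    fix t :: real assume t: "0 \<le> t" "t \<le> 1"
    have c: "x + t \<cdot>\<^sub>v h \<in> carrier_vec d" using assms by simp
    define G where "G = grad d g (x + t \<cdot>\<^sub>v h)"
    have G: "G \<in> carrier_vec d" "grad d g x \<in> carrier_vec d"
      using grad_carrier[OF D] c assms by (auto simp: G_def)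
    have "(\<psi> has_real_derivative (G \<bullet> h - grad d g x \<bullet> h - L / 2 * (vnorm h)\<^sup>2 * (2 * t))) (at t)"
      unfolding \<psi>_def G_def
      by (auto intro!: derivative_eq_intros has_grad_line_derivative[OF has_grad_grad[OF D c]] assms)
    moreover have "G \<bullet> h - grad d g x \<bullet> h - L / 2 * (vnorm h)\<^sup>2 * (2 * t) \<le> 0"
    proof -
      have "G \<bullet> h - grad d g x \<bullet> h = (G - grad d g x) \<bullet> h"
        using G assms by (simp add: minus_scalar_prod_distrib)
      also have "\<dots> \<le> vnorm (G - grad d g x) * vnorm h"
        using abs_scalar_prod_le[of "G - grad d g x" d h] G assms by simp
      also have "\<dots> \<le> (L * vnorm (x + t \<cdot>\<^sub>v h - x)) * vnorm h"
        using assms c by (intro mult_right_mono) (auto simp: L_smooth_def G_def)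
      also have "x + t \<cdot>\<^sub>v h - x = t \<cdot>\<^sub>v h" using assms by auto
      finally show ?thesis using t by (simp add: vnorm_smult power2_eq_square algebra_simps)
    qed
    ultimately show "\<exists>y. (\<psi> has_real_derivative y) (at t) \<and> y \<le> 0" by blast
  qed simp
  moreover have "x + 0 \<cdot>\<^sub>v h = x" using assms by auto
  ultimately show ?thesis by (simp add: \<psi>_def)
qed

subsection \<open>Matrices between multiples of the identity\<close>

lemma smult_one_mult_mat_vec:
  fixes u :: "real vec"
  assumes "u \<in> carrier_vec d"
  shows "(c \<cdot>\<^sub>m 1\<^sub>m d) *\<^sub>v u = c \<cdot>\<^sub>v u"
proof (rule eq_vecI)
  fix i assume "i < dim_vec (c \<cdot>\<^sub>v u)"
  then have i: "i < d" using assms by simp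
  then have "row (c \<cdot>\<^sub>m 1\<^sub>m d) i = c \<cdot>\<^sub>v unit_vec d i" by (intro eq_vecI) auto
  then show "((c \<cdot>\<^sub>m 1\<^sub>m d) *\<^sub>v u) $ i = (c \<cdot>\<^sub>v u) $ i" using i assms by simp
qed (use assms in simp)

text \<open>The order constrains only the difference of the two matrices; since a multiple of the
  identity is symmetric, the shape and the symmetry of \<open>H\<close> can be read off from that
  difference.\<close>

lemma loewner_le_smult_oneD:
  assumes "loewner_le d H (c \<cdot>\<^sub>m 1\<^sub>m d)"
  shows "H \<in> carrier_mat d d" "H\<^sup>T = H"
    and "\<And>u. u \<in> carrier_vec d \<Longrightarrow> u \<bullet> (H *\<^sub>v u) \<le> c * (vnorm u)\<^sup>2"
proof -
  let ?M = "c \<cdot>\<^sub>m 1\<^sub>m d - H"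
  have M: "?M \<in> carrier_mat d d" "?M\<^sup>T = ?M" "\<And>u. u \<in> carrier_vec d \<Longrightarrow> 0 \<le> u \<bullet> (?M *\<^sub>v u)"
    using assms by (auto simp: loewner_le_def pos_semidef_def)
  show H: "H \<in> carrier_mat d d" using carrier_matD[OF M(1)] by (intro carrier_matI) auto
  show "H\<^sup>T = H"
  proof (rule eq_matI)
    fix i j assume ij: "i < dim_row H" "j < dim_col H"
    have "?M\<^sup>T $$ (i, j) = ?M $$ (i, j)" using M(2) by simp
    then show "H\<^sup>T $$ (i, j) = H $$ (i, j)" using ij H by (auto split: if_splits)
  qed (use H in auto)
  show "u \<bullet> (H *\<^sub>v u) \<le> c * (vnorm u)\<^sup>2" if u: "u \<in> carrier_vec d" for u
  proof -
    have "?M *\<^sub>v u = c \<cdot>\<^sub>v u - H *\<^sub>v u"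
      using u H by (subst minus_mult_distrib_mat_vec[of _ d d]) (auto simp: smult_one_mult_mat_vec)
    then have "u \<bullet> (?M *\<^sub>v u) = c * (u \<bullet> u) - u \<bullet> (H *\<^sub>v u)"
      using u H scalar_prod_minus_distrib[of u d "c \<cdot>\<^sub>v u" "H *\<^sub>v u"] by simp
    then show ?thesis using M(3)[OF u] by (simp add: vnorm_square)
  qed
qed

lemma smult_one_loewner_leD:
  assumes "loewner_le d (c \<cdot>\<^sub>m 1\<^sub>m d) H" "H \<in> carrier_mat d d" "u \<in> carrier_vec d"
  shows "c * (vnorm u)\<^sup>2 \<le> u \<bullet> (H *\<^sub>v u)"
proof -
  let ?M = "H - c \<cdot>\<^sub>m 1\<^sub>m d"
  have "?M *\<^sub>v u = H *\<^sub>v u - c \<cdot>\<^sub>v u"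
    using assms by (subst minus_mult_distrib_mat_vec[of _ d d]) (auto simp: smult_one_mult_mat_vec)
  then have "u \<bullet> (?M *\<^sub>v u) = u \<bullet> (H *\<^sub>v u) - c * (u \<bullet> u)"
    using assms scalar_prod_minus_distrib[of u d "H *\<^sub>v u" "c \<cdot>\<^sub>v u"] by simp
  moreover have "0 \<le> u \<bullet> (?M *\<^sub>v u)"
    using assms by (auto simp: loewner_le_def pos_semidef_def)
  ultimately show ?thesis by (simp add: vnorm_square)
qed

text \<open>A bound on the quadratic form yields a norm bound without eigenvalues: positivity of the
  form is evaluated at \<open>u - w / c\<close> with \<open>w = H u\<close>, and the upper bound is
  applied once to \<open>w\<close> and once to \<open>u\<close>.\<close>

lemma vnorm_mult_mat_vec_le:
  assumes H: "H \<in> carrier_mat d d" "H\<^sup>T = H"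
    and psd: "\<And>u. u \<in> carrier_vec d \<Longrightarrow> 0 \<le> u \<bullet> (H *\<^sub>v u)"
    and le: "\<And>u. u \<in> carrier_vec d \<Longrightarrow> u \<bullet> (H *\<^sub>v u) \<le> c * (vnorm u)\<^sup>2"
    and c: "c > 0" and u: "u \<in> carrier_vec d"
  shows "vnorm (H *\<^sub>v u) \<le> c * vnorm u"
proof -
  define w where "w = H *\<^sub>v u"
  have w: "w \<in> carrier_vec d" using H u by (simp add: w_def)
  have Hw: "H *\<^sub>v w \<in> carrier_vec d" using H w by simp
  \<comment> \<open>Symmetry of \<open>H\<close> enters here, to move it from one side of the scalar
    product to the other.\<close>
  have uHw: "u \<bullet> (H *\<^sub>v w) = w \<bullet> w"
    using H u w transpose_vec_mult_scalar[of H d d w u] by (simp add: w_def)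
  have "H *\<^sub>v (u - (1 / c) \<cdot>\<^sub>v w) = w - (1 / c) \<cdot>\<^sub>v (H *\<^sub>v w)"
    using H u w by (simp add: mult_minus_distrib_mat_vec[of _ d d] mult_mat_vec[of _ d d] w_def)
  then have "(u - (1 / c) \<cdot>\<^sub>v w) \<bullet> (H *\<^sub>v (u - (1 / c) \<cdot>\<^sub>v w))
      = u \<bullet> w - 1 / c * (u \<bullet> (H *\<^sub>v w)) - 1 / c * (w \<bullet> w - 1 / c * (w \<bullet> (H *\<^sub>v w)))"
    using u w Hw
    by (simp add: minus_scalar_prod_distrib[of _ d] scalar_prod_minus_distrib[of _ d] algebra_simps)
  moreover have "0 \<le> (u - (1 / c) \<cdot>\<^sub>v w) \<bullet> (H *\<^sub>v (u - (1 / c) \<cdot>\<^sub>v w))"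
    using u w by (intro psd) auto
  ultimately have *: "0 \<le> u \<bullet> w - 2 / c * (w \<bullet> w) + (1 / c)\<^sup>2 * (w \<bullet> (H *\<^sub>v w))"
    by (simp add: uHw algebra_simps power2_eq_square)
  have "(1 / c)\<^sup>2 * (w \<bullet> (H *\<^sub>v w)) \<le> (1 / c)\<^sup>2 * (c * (vnorm w)\<^sup>2)"
    using le[OF w] by (intro mult_left_mono) auto
  also have "\<dots> = (vnorm w)\<^sup>2 / c" using c by (simp add: field_simps power2_eq_square)
  finally have "0 \<le> c * (vnorm u)\<^sup>2 - (vnorm w)\<^sup>2 / c"
    using * le[OF u] by (simp add: w_def vnorm_square)
  then have "(vnorm w)\<^sup>2 \<le> (c * vnorm u)\<^sup>2"
    using c by (simp add: field_simps power2_eq_square)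
  then show ?thesis
    unfolding w_def using c by (auto intro: power2_le_imp_le)
qed

subsection \<open>Expectations under finitely supported laws\<close>

text \<open>Finite support reduces both sides to finite sums, so the law of iterated expectations
  holds for every real function.\<close>

lemma expectation_bind_pmf_finite:
  fixes h :: "'b \<Rightarrow> real"
  assumes "finite (set_pmf p)" "\<And>x. x \<in> set_pmf p \<Longrightarrow> finite (set_pmf (f x))"
  shows "measure_pmf.expectation (bind_pmf p f) h =
         measure_pmf.expectation p (\<lambda>x. measure_pmf.expectation (f x) h)"
  using assms
  by (subst pmf_expectation_bind[of "set_pmf p"], simp_all)
     (subst integral_measure_pmf[of "set_pmf p"], simp_all)

lemma expectation_mono_finite:
  fixes g h :: "'a \<Rightarrow> real"
  assumes "finite (set_pmf p)" "\<And>x. x \<in> set_pmf p \<Longrightarrow> g x \<le> h x"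
  shows "measure_pmf.expectation p g \<le> measure_pmf.expectation p h"
  using assms by (intro integral_mono_AE) (auto simp: integrable_measure_pmf_finite AE_measure_pmf_iff)

lemma expectation_cong_set_pmf:
  fixes g h :: "'a \<Rightarrow> real"
  assumes "\<And>x. x \<in> set_pmf p \<Longrightarrow> g x = h x"
  shows "measure_pmf.expectation p g = measure_pmf.expectation p h"
  using assms by (intro integral_cong_AE) (auto simp: AE_measure_pmf_iff)

lemma finite_set_replicate_pmf:
  assumes "finite (set_pmf p)"
  shows "finite (set_pmf (replicate_pmf b p))"
  using finite_lists_length_eq[OF assms, of b]
  by (auto simp: set_replicate_pmf lists_eq_set elim: finite_subset[rotated])

section \<open>Second moments of mini-batch means\<close>

text \<open>Independent centred summands have vanishing cross terms. The offset \<open>t\<close> is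
  general because the induction absorbs the first draw into it.\<close>

lemma expectation_replicate_pmf_sum_square:
  fixes g :: "'a \<Rightarrow> real"
  assumes fin: "finite (set_pmf p)" and mean: "measure_pmf.expectation p g = 0"
  shows "measure_pmf.expectation (replicate_pmf b p) (\<lambda>xs. ((\<Sum>x\<leftarrow>xs. g x) + t)\<^sup>2)
         = t\<^sup>2 + real b * measure_pmf.expectation p (\<lambda>x. (g x)\<^sup>2)"
proof (induction b arbitrary: t)
  case 0
  then show ?case by simp
next
  case (Suc b)
  note [simp] = integrable_measure_pmf_finite[OF fin]
  let ?V = "measure_pmf.expectation p (\<lambda>x. (g x)\<^sup>2)"
  have "measure_pmf.expectation (replicate_pmf (Suc b) p) (\<lambda>xs. ((\<Sum>x\<leftarrow>xs. g x) + t)\<^sup>2)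
      = measure_pmf.expectation p (\<lambda>x. measure_pmf.expectation (replicate_pmf b p)
          (\<lambda>xs. ((\<Sum>x\<leftarrow>xs. g x) + (g x + t))\<^sup>2))"
    using fin finite_set_replicate_pmf[OF fin, of b]
    by (simp add: expectation_bind_pmf_finite add.left_commute add.assoc)
  also have "\<dots> = measure_pmf.expectation p (\<lambda>x. (g x + t)\<^sup>2 + real b * ?V)"
    unfolding Suc.IH ..
  also have "\<dots> = measure_pmf.expectation p (\<lambda>x. (g x)\<^sup>2 + (2 * t) * g x + (t\<^sup>2 + real b * ?V))"
    by (simp add: power2_sum algebra_simps)
  also have "\<dots> = ?V + (2 * t) * measure_pmf.expectation p g + (t\<^sup>2 + real b * ?V)"
    by simp
  finally show ?case using mean by (simp add: algebra_simps)
qed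

text \<open>The batch mean minus \<open>\<mu>\<close> is centred, so its variance adds to the square
  of the fixed offset \<open>t\<close>, with the factor \<open>1 / b\<close> of averaging. Later
  \<open>t\<close> is a coordinate of the preceding error.\<close>

lemma expectation_batch_mean_square_le:
  fixes g :: "nat \<Rightarrow> real"
  assumes "n \<ge> 1" "b \<ge> 1"
  defines "\<mu> \<equiv> (\<Sum>i=1..n. g i) / real n"
  shows "measure_pmf.expectation (replicate_pmf b (pmf_of_set {1..n}))
           (\<lambda>is. ((\<Sum>i\<leftarrow>is. g i) / real (length is) - \<mu> + t)\<^sup>2)
         \<le> t\<^sup>2 + (\<Sum>i=1..n. (g i)\<^sup>2) / (real n * real b)"
proof -
  let ?p = "pmf_of_set {1..n}"
  have ne: "{1..n} \<noteq> {}" using assms(1) by simp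
  have fin: "finite (set_pmf ?p)" using ne by (simp add: set_pmf_of_set)
  have E: "measure_pmf.expectation ?p h = (\<Sum>i=1..n. h i) / real n" for h :: "nat \<Rightarrow> real"
    using ne by (subst integral_pmf_of_set) auto
  \<comment> \<open>Centring and division by the batch size go into each summand, which turns the
    batch mean into a plain sum of centred draws.\<close>
  define g' where "g' i = (g i - \<mu>) / real b" for i
  have split: "(\<Sum>i\<leftarrow>is. g' i) = ((\<Sum>i\<leftarrow>is. g i) - real (length is) * \<mu>) / real b" for "is"
    by (induction "is") (auto simp: g'_def field_simps diff_divide_distrib add_divide_distrib)
  have "(\<Sum>i=1..n. g' i) = ((\<Sum>i=1..n. g i) - real n * \<mu>) / real b"
    by (simp add: g'_def sum_divide_distrib[symmetric] sum_subtractf)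
  then have mean: "measure_pmf.expectation ?p g' = 0"
    using assms(1) unfolding E by (simp add: \<mu>_def)
  have "measure_pmf.expectation (replicate_pmf b ?p)
          (\<lambda>is. ((\<Sum>i\<leftarrow>is. g i) / real (length is) - \<mu> + t)\<^sup>2)
      = measure_pmf.expectation (replicate_pmf b ?p) (\<lambda>is. ((\<Sum>i\<leftarrow>is. g' i) + t)\<^sup>2)"
    using assms(2)
    by (intro expectation_cong_set_pmf) (auto simp: set_replicate_pmf split diff_divide_distrib)
  also have "\<dots> = t\<^sup>2 + real b * ((\<Sum>i=1..n. (g' i)\<^sup>2) / real n)"
    unfolding expectation_replicate_pmf_sum_square[OF fin mean] E ..
  also have "(\<Sum>i=1..n. (g' i)\<^sup>2) = (\<Sum>i=1..n. (g i - \<mu>)\<^sup>2) / (real b)\<^sup>2"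
    by (simp add: g'_def power_divide sum_divide_distrib)
  also have "(\<Sum>i=1..n. (g i - \<mu>)\<^sup>2) = (\<Sum>i=1..n. (g i)\<^sup>2) - 2 * \<mu> * (\<Sum>i=1..n. g i) + real n * \<mu>\<^sup>2"
    by (simp add: power2_diff sum.distrib sum_subtractf sum_distrib_left algebra_simps)
  also have "\<dots> = (\<Sum>i=1..n. (g i)\<^sup>2) - real n * \<mu>\<^sup>2"
    using assms(1) by (simp add: \<mu>_def power2_eq_square)
  \<comment> \<open>The variance is at most the raw second moment: the square of the mean is
    dropped.\<close>
  also have "real b * (((\<Sum>i=1..n. (g i)\<^sup>2) - real n * \<mu>\<^sup>2) / (real b)\<^sup>2 / real n)
      \<le> real b * ((\<Sum>i=1..n. (g i)\<^sup>2) / (real b)\<^sup>2 / real n)"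
    by (intro mult_left_mono divide_right_mono) auto
  also have "\<dots> = (\<Sum>i=1..n. (g i)\<^sup>2) / (real n * real b)"
    using assms(2) by (simp add: power2_eq_square)
  finally show ?thesis by simp
qed

section \<open>Product laws and resampling of one coordinate\<close>

lemma finite_set_Pi_pmf:
  assumes "finite A" "\<And>k. k \<in> A \<Longrightarrow> finite (set_pmf (p k))"
  shows "finite (set_pmf (Pi_pmf A dflt p))"
  by (rule finite_subset[OF set_Pi_pmf_subset'[OF assms(1)] finite_PiE_dflt]) (use assms in simp_all)

lemma expectation_Pi_pmf_split:
  fixes F :: "_ \<Rightarrow> real"
  assumes A: "finite A" "k \<in> A" and fin: "\<And>k. k \<in> A \<Longrightarrow> finite (set_pmf (p k))"
  shows "measure_pmf.expectation (Pi_pmf A dflt p) F =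
         measure_pmf.expectation (Pi_pmf (A - {k}) dflt p)
           (\<lambda>\<xi>. measure_pmf.expectation (p k) (\<lambda>y. F (\<xi>(k := y))))"
proof -
  have f: "finite (set_pmf (p k))" "finite (set_pmf (Pi_pmf (A - {k}) dflt p))"
    using assms by (auto intro: finite_set_Pi_pmf)
  have "Pi_pmf A dflt p = do {\<xi> \<leftarrow> Pi_pmf (A - {k}) dflt p; y \<leftarrow> p k; return_pmf (\<xi>(k := y))}"
    using Pi_pmf_insert'[of "A - {k}" k dflt p] A bind_commute_pmf[of "p k"]
    by (simp add: insert_absorb)
  then show ?thesis using f by (simp add: expectation_bind_pmf_finite)
qed

text \<open>Conditioning on all coordinates but the \<open>k\<close>-th, written as resampling the \<open>k\<close>-th one.\<close>

lemma expectation_Pi_pmf_resample: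
  fixes F :: "_ \<Rightarrow> real"
  assumes "finite A" "k \<in> A" "\<And>k. k \<in> A \<Longrightarrow> finite (set_pmf (p k))"
  shows "measure_pmf.expectation (Pi_pmf A dflt p) F =
         measure_pmf.expectation (Pi_pmf A dflt p)
           (\<lambda>\<xi>. measure_pmf.expectation (p k) (\<lambda>y. F (\<xi>(k := y))))"
  \<comment> \<open>Both sides are split at \<open>k\<close>. On the right the inner overwriting
    erases the outer one, so the extra expectation is that of a constant.\<close>
  by (subst (1 2) expectation_Pi_pmf_split[where k = k and A = A]) (use assms in simp_all)

section \<open>Counting over epochs\<close>

text \<open>As \<open>a\<close> is reset at multiples of \<open>q\<close>, an increment
  \<open>w k\<close> can influence at most \<open>q\<close> of the terms \<open>a i\<close>. Later
  \<open>a\<close> is the mean squared error and \<open>w\<close> its growth per step.\<close>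

lemma sum_recursion_mod_le:
  fixes a w :: "nat \<Rightarrow> real"
  assumes "q \<ge> 1" and a0: "\<And>k. q dvd k \<Longrightarrow> k < K \<Longrightarrow> a k = 0"
    and aS: "\<And>k. \<not> q dvd Suc k \<Longrightarrow> Suc k < K \<Longrightarrow> a (Suc k) \<le> a k + w k"
    and nonneg: "\<And>k. k < K \<Longrightarrow> 0 \<le> a k" "\<And>k. k < K \<Longrightarrow> 0 \<le> w k"
  shows "(\<Sum>k<K. a k) \<le> real q * (\<Sum>k<K. w k)"
proof -
  have mod: "J mod q < q" for J using assms(1) by simp
  \<comment> \<open>The factor of \<open>a J\<close> counts the indices from \<open>J\<close> to the end of its epoch: the bound on \<open>a J\<close> persists there.\<close>
  have *: "(\<Sum>k<J. a k) + (real q - real (J mod q)) * a J \<le> real q * (\<Sum>k<J. w k)" if "J < K" for J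
    using that
  proof (induction J)
    case 0
    then show ?case using a0[of 0] by simp
  next
    case (Suc J)
    then have IH: "(\<Sum>k<J. a k) + (real q - real (J mod q)) * a J \<le> real q * (\<Sum>k<J. w k)"
      and J: "0 \<le> a J" "0 \<le> w J" using nonneg by auto
    show ?case
    proof (cases "q dvd Suc J")
      case True
      \<comment> \<open>The reserved weight is at least 1, which pays for the last term of the
        finished epoch; the next epoch starts from zero.\<close>
      have "a J \<le> (real q - real (J mod q)) * a J"
        using mod[of J] J by (intro mult_right_mono[of 1 "real q - real (J mod q)" "a J", unfolded mult_1]) linarith+
      moreover have "0 \<le> real q * w J" using J by simp
      ultimately show ?thesis using a0[OF True] Suc.prems IH by (simp add: algebra_simps)
    next
      case False
      then have m: "Suc J mod q = Suc (J mod q)"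
        by (metis mod_Suc mod_eq_0_iff_dvd)
      have c: "0 \<le> real q - real (Suc (J mod q))" using mod[of J] by linarith
      have "(real q - real (Suc (J mod q))) * a (Suc J) \<le> (real q - real (Suc (J mod q))) * (a J + w J)"
        using aS[OF False] Suc.prems c by (intro mult_left_mono) auto
      \<comment> \<open>One unit of the weight is released to pay for \<open>a J\<close>, which now
        joins the sum.\<close>
      also have "\<dots> \<le> (real q - real (J mod q)) * a J - a J + real q * w J"
        using J by (simp add: algebra_simps)
      finally show ?thesis using IH by (simp add: m algebra_simps)
    qed
  qed
  show ?thesis
  proof (cases K)
    case (Suc J)
    have "a J \<le> (real q - real (J mod q)) * a J"
      using mod[of J] nonneg(1)[of J] Suc by (intro mult_right_mono[of 1 "real q - real (J mod q)" "a J", unfolded mult_1]) linarith+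
    moreover have "0 \<le> real q * w J" using nonneg(2)[of J] Suc by simp
    ultimately show ?thesis using *[of J] Suc by (simp add: algebra_simps)
  qed simp
qed

text \<open>Distinct multiples have distinct quotients by \<open>q\<close>. The \<open>Suc\<close>
  accounts for the multiple 0, and the quotient uses \<open>K - 1\<close> because that is the
  largest admissible index.\<close>

lemma card_multiples_lessThan_le:
  assumes "q \<ge> 1" "K \<ge> 1"
  shows "card {k \<in> {..<K}. q dvd k} \<le> Suc ((K - 1) div q)"
proof -
  have "card {k \<in> {..<K}. q dvd k} \<le> card {..(K - 1) div q}"
  proof (rule card_inj_on_le)
    show "inj_on (\<lambda>k. k div q) {k \<in> {..<K}. q dvd k}"
      by (auto intro!: inj_onI simp: dvd_div_eq_iff)
    show "(\<lambda>k. k div q) ` {k \<in> {..<K}. q dvd k} \<subseteq> {..(K - 1) div q}"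
      by (auto intro!: div_le_mono)
  qed simp
  then show ?thesis by simp
qed

subsection \<open>Runs of the algorithm\<close>

text \<open>Updates are applied for \<open>j < k\<close> only, and the pair with index
  \<open>j\<close> reads entries \<open>j\<close> and \<open>Suc j\<close>. Hence the matrix is
  causal.\<close>

lemma lbfgs_H_cong:
  assumes "\<And>i. i \<le> k \<Longrightarrow> x i = x' i" "\<And>i. i \<le> k \<Longrightarrow> v i = v' i"
  shows "lbfgs_H d m \<delta> \<gamma>0 x v k = lbfgs_H d m \<delta> \<gamma>0 x' v' k"
proof -
  have s: "lbfgs_s x j = lbfgs_s x' j" "lbfgs_ybar v j = lbfgs_ybar v' j" if "j < k" for j
    using assms that by (auto simp: lbfgs_s_def lbfgs_ybar_def)
  then have \<gamma>: "lbfgs_gamma \<delta> \<gamma>0 x v j = lbfgs_gamma \<delta> \<gamma>0 x' v' j" if "j \<le> k" for j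
    using that by (cases j) auto
  have y: "lbfgs_yhat d \<delta> \<gamma>0 x v j = lbfgs_yhat d \<delta> \<gamma>0 x' v' j" if "j < k" for j
    using s[OF that] \<gamma>[of "Suc j"] that
    by (simp add: lbfgs_yhat_def lbfgs_theta_def lbfgs_sigma_def lbfgs_H0_inv_def
        del: lbfgs_gamma.simps)
  show ?thesis
    unfolding lbfgs_H_def
  proof (rule List.fold_cong)
    show "lbfgs_update d \<delta> \<gamma>0 x v j = lbfgs_update d \<delta> \<gamma>0 x' v' j" if "j \<in> set [k - m..<k]" for j
      using that s[of j] y[of j] by (simp add: lbfgs_update_def[abs_def])
  qed (use \<gamma>[of k] in \<open>simp_all add: lbfgs_H0_def\<close>)
qed

text \<open>Causality of the algorithm: batch \<open>k\<close> first enters through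
  \<open>v k\<close>, and then through \<open>x (Suc k)\<close>. This is what makes
  \<open>\<xi> k\<close> independent of \<open>x k\<close>, \<open>x (k - 1)\<close> and
  \<open>v (k - 1)\<close>.\<close>

lemma spidersqn_run_cong:
  assumes "spidersqn_run d n f q \<eta> m \<delta> \<gamma>0 K x0 \<xi> x v"
    and "spidersqn_run d n f q \<eta> m \<delta> \<gamma>0 K x0 \<xi>' x' v'"
    and "k \<le> K" "\<And>i. i < k \<Longrightarrow> \<xi> i = \<xi>' i"
  shows "(\<forall>i\<le>k. x i = x' i) \<and> (\<forall>i<k. v i = v' i)"
  using assms(3,4)
proof (induction k)
  case 0
  then show ?case using assms(1,2) by (simp add: spidersqn_run_def)
next
  case (Suc k)
  then have x: "\<And>i. i \<le> k \<Longrightarrow> x i = x' i" and v: "\<And>i. i < k \<Longrightarrow> v i = v' i" and k: "k < K"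
    by auto
  have vk: "v k = v' k"
  proof (cases "q dvd k")
    case True
    then show ?thesis using assms(1,2) k x[of k] by (simp add: spidersqn_run_def)
  next
    case False
    \<comment> \<open>Index 0 is a multiple of \<open>q\<close>, so a mini-batch step always has a
      genuine predecessor \<open>k - 1\<close>.\<close>
    then have "k \<noteq> 0" by (metis dvd_0_right)
    then have "v (k - 1) = v' (k - 1)" "x (k - 1) = x' (k - 1)" using v x by auto
    then show ?thesis
      using assms(1,2) k x[of k] False Suc.prems(2)[of k] by (simp add: spidersqn_run_def)
  qed
  then have v': "\<And>i. i \<le> k \<Longrightarrow> v i = v' i" using v by (metis le_neq_implies_less)
  have "lbfgs_H d m \<delta> \<gamma>0 x v k = lbfgs_H d m \<delta> \<gamma>0 x' v' k"
    using x v' by (rule lbfgs_H_cong)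
  then have "x (Suc k) = x' (Suc k)"
    using assms(1,2) k x[of k] vk by (simp add: spidersqn_run_def)
  then show ?case using x v' by (auto simp: le_Suc_eq less_Suc_eq_le)
qed

text \<open>The step size is arbitrary here; the chosen one makes \<open>L * \<eta> * smax\<^sup>2 / smin\<close> the inverse golden
  ratio, which is below \<open>2 / 3\<close>.\<close>

locale spidersqn =
  fixes d n q m K :: nat and L \<eta> smin smax \<delta> \<gamma>0 :: real
    and f :: "nat \<Rightarrow> real vec \<Rightarrow> real" and x0 :: "real vec"
    and x v :: "(nat \<Rightarrow> nat list) \<Rightarrow> nat \<Rightarrow> real vec"
  assumes n: "n \<ge> 1" and q: "q \<ge> 1" and L: "L > 0" and \<eta>: "\<eta> > 0" and smin: "smin > 0" and smax: "smax > 0"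
    and x0: "x0 \<in> carrier_vec d"
    and smooth: "\<And>i. i \<in> {1..n} \<Longrightarrow> L_smooth d L (f i)"
    and run: "\<And>\<xi>. \<xi> \<in> set_pmf (batches_pmf n q q K) \<Longrightarrow>
      spidersqn_run d n f q \<eta> m \<delta> \<gamma>0 K x0 \<xi> (x \<xi>) (v \<xi>)"
    and H_ge: "\<And>\<xi> k. \<xi> \<in> set_pmf (batches_pmf n q q K) \<Longrightarrow> k < K \<Longrightarrow>
      loewner_le d (smin \<cdot>\<^sub>m 1\<^sub>m d) (lbfgs_H d m \<delta> \<gamma>0 (x \<xi>) (v \<xi>) k)"
    and H_le: "\<And>\<xi> k. \<xi> \<in> set_pmf (batches_pmf n q q K) \<Longrightarrow> k < K \<Longrightarrow>
      loewner_le d (lbfgs_H d m \<delta> \<gamma>0 (x \<xi>) (v \<xi>) k) (smax \<cdot>\<^sub>m 1\<^sub>m d)"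
begin

abbreviation "P \<equiv> batches_pmf n q q K"
abbreviation "F \<equiv> objective n f"
abbreviation "G \<equiv> grad d (objective n f)"
abbreviation "E \<equiv> measure_pmf.expectation P"

definition batch_law :: "nat \<Rightarrow> nat list pmf" where
  "batch_law k = (if q dvd k then return_pmf [] else replicate_pmf q (pmf_of_set {1..n}))"

definition err :: "(nat \<Rightarrow> nat list) \<Rightarrow> nat \<Rightarrow> real vec" where
  "err \<xi> k = v \<xi> k - G (x \<xi> k)"

lemma P_eq: "P = Pi_pmf {..<K} [] batch_law"
  by (simp add: batches_pmf_def batch_law_def[abs_def])

lemma finite_batch_law: "finite (set_pmf (batch_law k))"
  using n finite_set_replicate_pmf[of "pmf_of_set {1..n}" q] by (simp add: batch_law_def set_pmf_of_set)

lemma finite_P: "finite (set_pmf P)"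
  unfolding P_eq by (intro finite_set_Pi_pmf finite_batch_law) simp

lemma integrable_P [simp]: "integrable P (g :: _ \<Rightarrow> real)"
  by (rule integrable_measure_pmf_finite[OF finite_P])

lemma length_batch_le:
  assumes "\<xi> \<in> set_pmf P" "k < K"
  shows "length (\<xi> k) \<le> q"
proof -
  have "\<xi> k \<in> set_pmf (batch_law k)"
    using assms unfolding P_eq by (auto simp: set_Pi_pmf PiE_dflt_def)
  then show ?thesis by (auto simp: batch_law_def set_replicate_pmf split: if_splits)
qed

lemma f_diff: "i \<in> {1..n} \<Longrightarrow> differentiable_everywhere d (f i)"
  using smooth by (simp add: L_smooth_def)

lemma F_smooth: "L_smooth d L F"
  using n L smooth by (intro L_smooth_objective) auto

lemma G_carrier: "y \<in> carrier_vec d \<Longrightarrow> G y \<in> carrier_vec d"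
  using F_smooth by (intro grad_carrier) (auto simp: L_smooth_def)

section \<open>Inequalities along a single run\<close>

context
  fixes \<xi> assumes \<xi>: "\<xi> \<in> set_pmf P"
begin

lemma H_carrier: "k < K \<Longrightarrow> lbfgs_H d m \<delta> \<gamma>0 (x \<xi>) (v \<xi>) k \<in> carrier_mat d d"
  using H_le[OF \<xi>] by (rule loewner_le_smult_oneD)

lemma v_unfold:
  "k < K \<Longrightarrow> v \<xi> k = (if q dvd k then G (x \<xi> k)
     else batch_grad d f (\<xi> k) (x \<xi> k) - batch_grad d f (\<xi> k) (x \<xi> (k - 1)) + v \<xi> (k - 1))"
  using run[OF \<xi>] unfolding spidersqn_run_def by blast

lemma x_Suc: "k < K \<Longrightarrow> x \<xi> (Suc k) = x \<xi> k - \<eta> \<cdot>\<^sub>v (lbfgs_H d m \<delta> \<gamma>0 (x \<xi>) (v \<xi>) k *\<^sub>v v \<xi> k)"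
  using run[OF \<xi>] unfolding spidersqn_run_def by blast

text \<open>Iterates and estimates depend on each other and need a joint induction; the estimates
  stop at \<open>K - 1\<close>, the iterates at \<open>K\<close>.\<close>

lemma x_v_carrier: "k \<le> K \<Longrightarrow> x \<xi> k \<in> carrier_vec d \<and> (k < K \<longrightarrow> v \<xi> k \<in> carrier_vec d)"
proof (induction k)
  case 0
  have "x \<xi> 0 = x0" using run[OF \<xi>] by (simp add: spidersqn_run_def)
  then show ?case using x0 v_unfold[of 0] G_carrier by auto
next
  case (Suc k)
  then have k: "k < K" "x \<xi> k \<in> carrier_vec d" "v \<xi> k \<in> carrier_vec d" by auto
  then have x: "x \<xi> (Suc k) \<in> carrier_vec d"
    using H_carrier[of k] by (simp add: x_Suc)
  moreover have "v \<xi> (Suc k) \<in> carrier_vec d" if "Suc k < K"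
    using v_unfold[OF that] k x G_carrier by (auto simp: batch_grad_def)
  ultimately show ?case by simp
qed

lemma x_carrier: "k \<le> K \<Longrightarrow> x \<xi> k \<in> carrier_vec d"
  and v_carrier: "k < K \<Longrightarrow> v \<xi> k \<in> carrier_vec d"
  and err_carrier: "k < K \<Longrightarrow> err \<xi> k \<in> carrier_vec d"
  using x_v_carrier[of k] G_carrier by (auto simp: err_def)

lemma vnorm_direction_le:
  assumes "k < K"
  shows "vnorm (lbfgs_H d m \<delta> \<gamma>0 (x \<xi>) (v \<xi>) k *\<^sub>v v \<xi> k) \<le> smax * vnorm (v \<xi> k)"
proof (rule vnorm_mult_mat_vec_le)
  let ?H = "lbfgs_H d m \<delta> \<gamma>0 (x \<xi>) (v \<xi>) k"
  note H = loewner_le_smult_oneD[OF H_le[OF \<xi> assms]]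
  show "?H \<in> carrier_mat d d" "?H\<^sup>T = ?H" by (fact H)+
  show "0 \<le> u \<bullet> (?H *\<^sub>v u)" if "u \<in> carrier_vec d" for u
    using smult_one_loewner_leD[OF H_ge[OF \<xi> assms] H(1) that] smin
    by (smt (verit) mult_nonneg_nonneg zero_le_power2)
  show "u \<bullet> (?H *\<^sub>v u) \<le> smax * (vnorm u)\<^sup>2" if "u \<in> carrier_vec d" for u
    using H(3)[OF that] .
qed (use smax assms v_carrier in auto)

lemma vnorm_step_le:
  assumes "k < K"
  shows "vnorm (x \<xi> (Suc k) - x \<xi> k) \<le> \<eta> * smax * vnorm (v \<xi> k)"
proof -
  define w where "w = lbfgs_H d m \<delta> \<gamma>0 (x \<xi>) (v \<xi>) k *\<^sub>v v \<xi> k"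
  have "w \<in> carrier_vec d" using H_carrier[OF assms] v_carrier[OF assms] by (simp add: w_def)
  then have "x \<xi> (Suc k) - x \<xi> k = (- \<eta>) \<cdot>\<^sub>v w"
    using x_carrier[of k] assms x_Suc[OF assms, folded w_def] by auto
  then have "vnorm (x \<xi> (Suc k) - x \<xi> k) = \<eta> * vnorm w"
    using \<eta> by (simp add: vnorm_smult)
  also have "\<dots> \<le> \<eta> * (smax * vnorm (v \<xi> k))"
    unfolding w_def using vnorm_direction_le[OF assms] \<eta> by (intro mult_left_mono) auto
  finally show ?thesis by simp
qed

text \<open>The gradient in the descent lemma is written as \<open>v - err\<close>. The part with
  \<open>v\<close> gains \<open>smin\<close>; Young's inequality on the part with \<open>err\<close>
  gives a second copy of the quadratic remainder, so the loss is
  \<open>L * \<eta> * smax\<^sup>2\<close> without a factor 1/2.\<close>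

lemma descent_step:
  assumes k: "k < K"
  shows "F (x \<xi> (Suc k)) \<le> F (x \<xi> k) - \<eta> * (smin - L * \<eta> * smax\<^sup>2) * (vnorm (v \<xi> k))\<^sup>2
           + (vnorm (err \<xi> k))\<^sup>2 / (2 * L)"
proof -
  let ?H = "lbfgs_H d m \<delta> \<gamma>0 (x \<xi>) (v \<xi>) k"
  define w where "w = ?H *\<^sub>v v \<xi> k"
  define g where "g = G (x \<xi> k)"
  note c = v_carrier[OF k] err_carrier[OF k] x_carrier[of k]
  have w: "w \<in> carrier_vec d" using H_carrier[OF k] c by (simp add: w_def)
  have g: "g \<in> carrier_vec d" using c k G_carrier by (simp add: g_def)
  define N where "N = vnorm w"
  have N: "0 \<le> N" "N \<le> smax * vnorm (v \<xi> k)"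
    using vnorm_direction_le[OF k] by (auto simp: N_def w_def)
  have "x \<xi> (Suc k) = x \<xi> k + (- \<eta>) \<cdot>\<^sub>v w"
    using c k w x_Suc[OF k] by (auto simp: w_def[symmetric])
  then have "F (x \<xi> (Suc k)) \<le> F (x \<xi> k) + g \<bullet> ((- \<eta>) \<cdot>\<^sub>v w) + L / 2 * (vnorm ((- \<eta>) \<cdot>\<^sub>v w))\<^sup>2"
    using L_smooth_descent[OF F_smooth, of "x \<xi> k" "(- \<eta>) \<cdot>\<^sub>v w"] c w k by (simp add: g_def)
  also have "\<dots> = F (x \<xi> k) - \<eta> * (g \<bullet> w) + L / 2 * \<eta>\<^sup>2 * N\<^sup>2"
    using g w by (simp add: vnorm_smult power_mult_distrib N_def)
  also have "g \<bullet> w = v \<xi> k \<bullet> w - err \<xi> k \<bullet> w"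
    using c g w minus_scalar_prod_distrib[of "v \<xi> k" d g w] by (simp add: err_def g_def)
  finally have 1: "F (x \<xi> (Suc k)) \<le> F (x \<xi> k) - \<eta> * (v \<xi> k \<bullet> w) + \<eta> * (err \<xi> k \<bullet> w) + L / 2 * \<eta>\<^sup>2 * N\<^sup>2"
    by (simp add: algebra_simps)
  have 2: "\<eta> * (smin * (vnorm (v \<xi> k))\<^sup>2) \<le> \<eta> * (v \<xi> k \<bullet> w)"
    unfolding w_def using \<eta> c H_carrier[OF k]
    by (intro mult_left_mono smult_one_loewner_leD[OF H_ge[OF \<xi> k]]) auto
  have "\<eta> * (err \<xi> k \<bullet> w) \<le> \<eta> * (vnorm (err \<xi> k) * N)"
    unfolding N_def using abs_scalar_prod_le[OF c(2) w] \<eta> by (intro mult_left_mono) auto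
  also have "\<dots> \<le> (vnorm (err \<xi> k))\<^sup>2 / (2 * L) + L / 2 * \<eta>\<^sup>2 * N\<^sup>2"
    \<comment> \<open>Young's inequality with weight \<open>L\<close>\<close>
  proof -
    have "0 \<le> (vnorm (err \<xi> k) - L * \<eta> * N)\<^sup>2 / (2 * L)" using L by simp
    also have "\<dots> = (vnorm (err \<xi> k))\<^sup>2 / (2 * L) + L / 2 * \<eta>\<^sup>2 * N\<^sup>2 - \<eta> * (vnorm (err \<xi> k) * N)"
      using L by (simp add: power2_diff field_simps power2_eq_square)
    finally show ?thesis by simp
  qed
  finally have 3: "\<eta> * (err \<xi> k \<bullet> w) \<le> (vnorm (err \<xi> k))\<^sup>2 / (2 * L) + L / 2 * \<eta>\<^sup>2 * N\<^sup>2" .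
  have "N\<^sup>2 \<le> (smax * vnorm (v \<xi> k))\<^sup>2" using N by (intro power_mono)
  then have 4: "L * \<eta>\<^sup>2 * N\<^sup>2 \<le> L * \<eta>\<^sup>2 * (smax * vnorm (v \<xi> k))\<^sup>2"
    using L by (intro mult_left_mono) auto
  show ?thesis
    using 1 2 3 4 by (simp add: algebra_simps power2_eq_square)
qed

text \<open>Smoothness transports the gradient from \<open>x k\<close> to the next iterate at a cost
  controlled by \<open>v k\<close>, so only the estimate at index \<open>k\<close> is
  involved.\<close>

lemma grad_next_le:
  assumes k: "k < K"
  shows "(vnorm (G (x \<xi> (Suc k))))\<^sup>2
    \<le> 2 * (vnorm (err \<xi> k))\<^sup>2 + 2 * (1 + L * \<eta> * smax)\<^sup>2 * (vnorm (v \<xi> k))\<^sup>2"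
proof -
  note c = v_carrier[OF k] err_carrier[OF k] x_carrier[of k] x_carrier[of "Suc k"]
  have xs: "x \<xi> (Suc k) \<in> carrier_vec d" "x \<xi> k \<in> carrier_vec d" using c k by auto
  have "vnorm (G (x \<xi> (Suc k))) \<le> vnorm (G (x \<xi> k)) + vnorm (G (x \<xi> (Suc k)) - G (x \<xi> k))"
    using xs by (intro vnorm_minus_le[of _ d] G_carrier)
  also have "vnorm (G (x \<xi> (Suc k)) - G (x \<xi> k)) \<le> L * vnorm (x \<xi> (Suc k) - x \<xi> k)"
    using F_smooth xs by (simp add: L_smooth_def)
  also have "\<dots> \<le> L * (\<eta> * smax * vnorm (v \<xi> k))"
    using vnorm_step_le[OF k] L by (intro mult_left_mono) auto
  also have "vnorm (G (x \<xi> k)) \<le> vnorm (v \<xi> k) + vnorm (err \<xi> k)"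
    using vnorm_minus_le[OF G_carrier[OF xs(2)] c(1)] vnorm_minus_commute[OF G_carrier[OF xs(2)] c(1)]
    by (simp add: err_def)
  finally have "vnorm (G (x \<xi> (Suc k))) \<le> vnorm (err \<xi> k) + (1 + L * \<eta> * smax) * vnorm (v \<xi> k)"
    by (simp add: algebra_simps)
  then have "(vnorm (G (x \<xi> (Suc k))))\<^sup>2 \<le> (vnorm (err \<xi> k) + (1 + L * \<eta> * smax) * vnorm (v \<xi> k))\<^sup>2"
    by (intro power_mono) auto
  also have "\<dots> \<le> 2 * (vnorm (err \<xi> k))\<^sup>2 + 2 * ((1 + L * \<eta> * smax) * vnorm (v \<xi> k))\<^sup>2"
    using zero_le_power2[of "vnorm (err \<xi> k) - (1 + L * \<eta> * smax) * vnorm (v \<xi> k)"]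
    unfolding power2_sum power2_diff by linarith
  finally show ?thesis by (simp add: power_mult_distrib)
qed

end

section \<open>Growth of the mean squared error\<close>

text \<open>Replacing batch \<open>k\<close> by another admissible one gives again an admissible run
  with the same past; it allows the conditional expectation to treat the past as fixed.\<close>

lemma resample:
  assumes "\<xi> \<in> set_pmf P" "k < K" "y \<in> set_pmf (batch_law k)"
  shows "\<xi>(k := y) \<in> set_pmf P"
    and "\<And>i. i \<le> k \<Longrightarrow> x (\<xi>(k := y)) i = x \<xi> i"
    and "\<And>i. i < k \<Longrightarrow> v (\<xi>(k := y)) i = v \<xi> i"
proof -
  show *: "\<xi>(k := y) \<in> set_pmf P"
    using assms unfolding P_eq by (auto simp: set_Pi_pmf PiE_dflt_def)
  show "\<And>i. i \<le> k \<Longrightarrow> x (\<xi>(k := y)) i = x \<xi> i" "\<And>i. i < k \<Longrightarrow> v (\<xi>(k := y)) i = v \<xi> i"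
    using spidersqn_run_cong[OF run[OF *] run[OF assms(1)], of k] assms(2) by auto
qed

text \<open>With the past fixed, the new error is the old one plus a centred batch mean of gradient
  differences. The variance bound is applied in each coordinate and summed, after which smoothness
  of the individual components bounds the differences.\<close>

lemma expectation_err_le:
  assumes \<xi>: "\<xi> \<in> set_pmf P" and k: "Suc k < K" "\<not> q dvd Suc k"
  shows "measure_pmf.expectation (batch_law (Suc k)) (\<lambda>y. (vnorm (err (\<xi>(Suc k := y)) (Suc k)))\<^sup>2)
    \<le> (vnorm (err \<xi> k))\<^sup>2 + L\<^sup>2 / real q * (vnorm (x \<xi> (Suc k) - x \<xi> k))\<^sup>2"
proof -
  let ?X = "x \<xi> (Suc k)" and ?Y = "x \<xi> k"
  have c: "?X \<in> carrier_vec d" "?Y \<in> carrier_vec d" "v \<xi> k \<in> carrier_vec d" "err \<xi> k \<in> carrier_vec d"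
    "G ?X \<in> carrier_vec d" "G ?Y \<in> carrier_vec d"
    using x_carrier[OF \<xi>] v_carrier[OF \<xi>] err_carrier[OF \<xi>] G_carrier k by auto
  have gc: "grad d (f i) ?X \<in> carrier_vec d" "grad d (f i) ?Y \<in> carrier_vec d" if "i \<in> {1..n}" for i
    using grad_carrier[OF f_diff[OF that]] c by auto
  define g where "g j i = grad d (f i) ?X $ j - grad d (f i) ?Y $ j" for j i
  have law: "batch_law (Suc k) = replicate_pmf q (pmf_of_set {1..n})"
    using k(2) by (simp add: batch_law_def)
  have idx: "err (\<xi>(Suc k := y)) (Suc k) $ j
      = (\<Sum>i\<leftarrow>y. g j i) / real (length y) - (\<Sum>i=1..n. g j i) / real n + err \<xi> k $ j"
    if y: "y \<in> set_pmf (batch_law (Suc k))" and j: "j < d" for y j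
  proof -
    note r = resample[OF \<xi> k(1) y]
    have "err (\<xi>(Suc k := y)) (Suc k)
        = batch_grad d f y ?X - batch_grad d f y ?Y + v \<xi> k - G ?X"
      using v_unfold[OF r(1) k(1)] k(2) r(2)[of "Suc k"] r(2)[of k] r(3)[of k] by (simp add: err_def)
    moreover have "err \<xi> k $ j = v \<xi> k $ j - (\<Sum>i=1..n. grad d (f i) ?Y $ j) / real n"
      using j c carrier_vecD[OF c(6)] grad_objective_index[of n ?Y d j f, OF n c(2) j f_diff]
      by (simp add: err_def)
    moreover have "(\<Sum>i\<leftarrow>y. g j i) / real (length y)
        = (\<Sum>i\<leftarrow>y. grad d (f i) ?X $ j) / real (length y) - (\<Sum>i\<leftarrow>y. grad d (f i) ?Y $ j) / real (length y)"
      by (simp add: g_def sum_list_subtractf diff_divide_distrib)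
    moreover have "(\<Sum>i=1..n. g j i) / real n
        = (\<Sum>i=1..n. grad d (f i) ?X $ j) / real n - (\<Sum>i=1..n. grad d (f i) ?Y $ j) / real n"
      by (simp add: g_def sum_subtractf diff_divide_distrib)
    ultimately show ?thesis
      using j carrier_vecD[OF c(5)] carrier_vecD[OF c(3)] grad_objective_index[of n ?X d j f, OF n c(1) j f_diff]
      by (simp add: batch_grad_def)
  qed
  note [simp] = integrable_measure_pmf_finite[OF finite_batch_law]
  have "measure_pmf.expectation (batch_law (Suc k)) (\<lambda>y. (vnorm (err (\<xi>(Suc k := y)) (Suc k)))\<^sup>2)
      = measure_pmf.expectation (batch_law (Suc k)) (\<lambda>y. \<Sum>j<d.
          ((\<Sum>i\<leftarrow>y. g j i) / real (length y) - (\<Sum>i=1..n. g j i) / real n + err \<xi> k $ j)\<^sup>2)"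
  proof (rule expectation_cong_set_pmf)
    fix y assume y: "y \<in> set_pmf (batch_law (Suc k))"
    have "err (\<xi>(Suc k := y)) (Suc k) \<in> carrier_vec d"
      using err_carrier[OF resample(1)[OF \<xi> k(1) y] k(1)] .
    then show "(vnorm (err (\<xi>(Suc k := y)) (Suc k)))\<^sup>2 = (\<Sum>j<d.
          ((\<Sum>i\<leftarrow>y. g j i) / real (length y) - (\<Sum>i=1..n. g j i) / real n + err \<xi> k $ j)\<^sup>2)"
      using idx[OF y] by (simp add: vnorm_square_sum)
  qed
  also have "\<dots> = (\<Sum>j<d. measure_pmf.expectation (batch_law (Suc k)) (\<lambda>y.
          ((\<Sum>i\<leftarrow>y. g j i) / real (length y) - (\<Sum>i=1..n. g j i) / real n + err \<xi> k $ j)\<^sup>2))"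
    by (intro Bochner_Integration.integral_sum) simp
  \<comment> \<open>The old error coordinate plays the role of the offset \<open>t\<close>.\<close>
  also have "\<dots> \<le> (\<Sum>j<d. (err \<xi> k $ j)\<^sup>2 + (\<Sum>i=1..n. (g j i)\<^sup>2) / (real n * real q))"
    unfolding law using n q by (intro sum_mono expectation_batch_mean_square_le) auto
  also have "\<dots> = (vnorm (err \<xi> k))\<^sup>2 + (\<Sum>i=1..n. \<Sum>j<d. (g j i)\<^sup>2) / (real n * real q)"
    using sum.swap[of "\<lambda>j i. (g j i)\<^sup>2" "{1..n}" "{..<d}"]
    by (simp add: sum.distrib vnorm_square_sum[OF c(4)] sum_divide_distrib[symmetric])
  also have "(\<Sum>i=1..n. \<Sum>j<d. (g j i)\<^sup>2) \<le> (\<Sum>i=1..n. (L * vnorm (?X - ?Y))\<^sup>2)"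
  proof (rule sum_mono)
    fix i assume i: "i \<in> {1..n}"
    have "(\<Sum>j<d. (g j i)\<^sup>2) = (vnorm (grad d (f i) ?X - grad d (f i) ?Y))\<^sup>2"
      using gc[OF i] carrier_vecD[OF gc(2)[OF i]]
      by (subst vnorm_square_sum[of _ d]) (auto simp: g_def)
    also have "\<dots> \<le> (L * vnorm (?X - ?Y))\<^sup>2"
      using smooth[OF i] c by (intro power_mono) (auto simp: L_smooth_def)
    finally show "(\<Sum>j<d. (g j i)\<^sup>2) \<le> (L * vnorm (?X - ?Y))\<^sup>2" .
  qed
  finally show ?thesis
    using n q by (simp add: divide_right_mono power_mult_distrib)
qed

section \<open>Averages over the mini-batches\<close>

definition mean_v :: "nat \<Rightarrow> real" where "mean_v k = E (\<lambda>\<xi>. (vnorm (v \<xi> k))\<^sup>2)"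
definition mean_err :: "nat \<Rightarrow> real" where "mean_err k = E (\<lambda>\<xi>. (vnorm (err \<xi> k))\<^sup>2)"

lemma mean_v_nonneg: "0 \<le> mean_v k" and mean_err_nonneg: "0 \<le> mean_err k"
  by (simp_all add: mean_v_def mean_err_def)

lemma mean_err_dvd:
  assumes "k < K" "q dvd k"
  shows "mean_err k = 0"
proof -
  have "mean_err k = E (\<lambda>\<xi>. 0)"
    unfolding mean_err_def
  proof (rule expectation_cong_set_pmf)
    fix \<xi> assume \<xi>: "\<xi> \<in> set_pmf P"
    have "err \<xi> k = 0\<^sub>v d"
      using v_unfold[OF \<xi> assms(1)] assms v_carrier[OF \<xi> assms(1)] by (auto simp: err_def)
    then show "(vnorm (err \<xi> k))\<^sup>2 = 0" by simp
  qed
  then show ?thesis by simp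
qed

lemma mean_err_Suc:
  assumes "Suc k < K" "\<not> q dvd Suc k"
  shows "mean_err (Suc k) \<le> mean_err k + (L * \<eta> * smax)\<^sup>2 / real q * mean_v k"
proof -
  \<comment> \<open>Resampling batch \<open>Suc k\<close> inside the expectation replaces
    conditioning on all other batches.\<close>
  have "mean_err (Suc k) = E (\<lambda>\<xi>. measure_pmf.expectation (batch_law (Suc k))
      (\<lambda>y. (vnorm (err (\<xi>(Suc k := y)) (Suc k)))\<^sup>2))"
    unfolding mean_err_def P_eq
    using assms finite_batch_law by (intro expectation_Pi_pmf_resample) auto
  also have "\<dots> \<le> E (\<lambda>\<xi>. (vnorm (err \<xi> k))\<^sup>2 + (L * \<eta> * smax)\<^sup>2 / real q * (vnorm (v \<xi> k))\<^sup>2)"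
  proof (rule expectation_mono_finite[OF finite_P])
    fix \<xi> assume \<xi>: "\<xi> \<in> set_pmf P"
    have "L\<^sup>2 / real q * (vnorm (x \<xi> (Suc k) - x \<xi> k))\<^sup>2 \<le> L\<^sup>2 / real q * (\<eta> * smax * vnorm (v \<xi> k))\<^sup>2"
      using vnorm_step_le[OF \<xi>] assms(1) by (intro mult_left_mono power_mono) auto
    also have "\<dots> = (L * \<eta> * smax)\<^sup>2 / real q * (vnorm (v \<xi> k))\<^sup>2"
      by (simp add: power_mult_distrib)
    finally show "measure_pmf.expectation (batch_law (Suc k))
        (\<lambda>y. (vnorm (err (\<xi>(Suc k := y)) (Suc k)))\<^sup>2)
      \<le> (vnorm (err \<xi> k))\<^sup>2 + (L * \<eta> * smax)\<^sup>2 / real q * (vnorm (v \<xi> k))\<^sup>2"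
      using expectation_err_le[OF \<xi> assms] by linarith
  qed
  also have "\<dots> = mean_err k + (L * \<eta> * smax)\<^sup>2 / real q * mean_v k"
    by (simp add: mean_err_def mean_v_def)
  finally show ?thesis .
qed

lemma sum_mean_err_le: "(\<Sum>k<K. mean_err k) \<le> (L * \<eta> * smax)\<^sup>2 * (\<Sum>k<K. mean_v k)"
proof -
  have "(\<Sum>k<K. mean_err k) \<le> real q * (\<Sum>k<K. (L * \<eta> * smax)\<^sup>2 / real q * mean_v k)"
    using q mean_err_dvd mean_err_Suc mean_v_nonneg mean_err_nonneg
    by (intro sum_recursion_mod_le) auto
  also have "\<dots> = (\<Sum>k<K. (L * \<eta> * smax)\<^sup>2 * mean_v k)"
    using q by (simp add: sum_distrib_left)
  finally show ?thesis by (simp add: sum_distrib_left)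
qed

text \<open>The averaged descent steps telescope. The coefficient 3/2 is 1 from the descent step
  plus 1/2 from the error sum after division by \<open>2 * L\<close>.\<close>

lemma sum_mean_v_le:
  assumes K: "K \<ge> 1" and bdd: "bdd_below (F ` carrier_vec d)"
  shows "\<eta> * (smin - 3 / 2 * (L * \<eta> * smax\<^sup>2)) * (\<Sum>k<K. mean_v k)
    \<le> F x0 - (INF y\<in>carrier_vec d. F y)"
proof -
  let ?c = "\<eta> * (smin - L * \<eta> * smax\<^sup>2)"
  have "E (\<lambda>\<xi>. F (x \<xi> k)) \<le> F x0 - ?c * (\<Sum>i<k. mean_v i) + (\<Sum>i<k. mean_err i) / (2 * L)"
    if "k \<le> K" for k
    using that
  proof (induction k)
    case 0
    have "E (\<lambda>\<xi>. F (x \<xi> 0)) = E (\<lambda>\<xi>. F x0)"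
      using run by (intro expectation_cong_set_pmf) (simp add: spidersqn_run_def)
    then show ?case by simp
  next
    case (Suc k)
    have "E (\<lambda>\<xi>. F (x \<xi> (Suc k)))
        \<le> E (\<lambda>\<xi>. F (x \<xi> k) - ?c * (vnorm (v \<xi> k))\<^sup>2 + (vnorm (err \<xi> k))\<^sup>2 / (2 * L))"
      using descent_step Suc.prems by (intro expectation_mono_finite[OF finite_P]) auto
    also have "\<dots> = E (\<lambda>\<xi>. F (x \<xi> k)) - ?c * mean_v k + mean_err k / (2 * L)"
      by (simp add: mean_v_def mean_err_def)
    finally show ?case
      using Suc by (simp add: algebra_simps add_divide_distrib)
  qed
  from this[of K] have 1: "E (\<lambda>\<xi>. F (x \<xi> K))
      \<le> F x0 - ?c * (\<Sum>i<K. mean_v i) + (\<Sum>i<K. mean_err i) / (2 * L)" by simp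
  have "(\<Sum>i<K. mean_err i) / (2 * L) \<le> (L * \<eta> * smax)\<^sup>2 * (\<Sum>k<K. mean_v k) / (2 * L)"
    using sum_mean_err_le L by (intro divide_right_mono) auto
  also have "\<dots> = \<eta> * (L * \<eta> * smax\<^sup>2 / 2) * (\<Sum>k<K. mean_v k)"
    using L by (simp add: power2_eq_square)
  finally have 2: "(\<Sum>i<K. mean_err i) / (2 * L) \<le> \<eta> * (L * \<eta> * smax\<^sup>2 / 2) * (\<Sum>k<K. mean_v k)" .
  have "E (\<lambda>\<xi>. INF y\<in>carrier_vec d. F y) \<le> E (\<lambda>\<xi>. F (x \<xi> K))"
    using x_carrier bdd by (intro expectation_mono_finite[OF finite_P] cINF_lower) auto
  then show ?thesis using 1 2 by (simp add: algebra_simps)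
qed

lemma sum_mean_grad_le:
  "(\<Sum>k<K. E (\<lambda>\<xi>. (vnorm (G (x \<xi> (Suc k))))\<^sup>2))
    \<le> 2 * ((L * \<eta> * smax)\<^sup>2 + (1 + L * \<eta> * smax)\<^sup>2) * (\<Sum>k<K. mean_v k)"
proof -
  have "(\<Sum>k<K. E (\<lambda>\<xi>. (vnorm (G (x \<xi> (Suc k))))\<^sup>2))
      \<le> (\<Sum>k<K. 2 * mean_err k + 2 * (1 + L * \<eta> * smax)\<^sup>2 * mean_v k)"
  proof (rule sum_mono)
    fix k assume "k \<in> {..<K}"
    then have "E (\<lambda>\<xi>. (vnorm (G (x \<xi> (Suc k))))\<^sup>2)
        \<le> E (\<lambda>\<xi>. 2 * (vnorm (err \<xi> k))\<^sup>2 + 2 * (1 + L * \<eta> * smax)\<^sup>2 * (vnorm (v \<xi> k))\<^sup>2)"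
      using grad_next_le by (intro expectation_mono_finite[OF finite_P]) auto
    then show "E (\<lambda>\<xi>. (vnorm (G (x \<xi> (Suc k))))\<^sup>2)
        \<le> 2 * mean_err k + 2 * (1 + L * \<eta> * smax)\<^sup>2 * mean_v k"
      by (simp add: mean_err_def mean_v_def)
  qed
  also have "\<dots> = 2 * (\<Sum>k<K. mean_err k) + 2 * (1 + L * \<eta> * smax)\<^sup>2 * (\<Sum>k<K. mean_v k)"
    by (simp add: sum.distrib sum_distrib_left)
  finally show ?thesis using sum_mean_err_le by (simp add: algebra_simps)
qed

section \<open>Quality of the output and number of oracle calls\<close>

text \<open>The bound is first shown for the second moment, where uniform \<open>\<zeta>\<close>
  turns the expectation into an average over iterates; Jensen's inequality then passes to the
  norm.\<close>

lemma expectation_grad_output_le: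
  assumes K: "K \<ge> 1" and bdd: "bdd_below (F ` carrier_vec d)" and \<epsilon>: "\<epsilon> > 0"
    and pos: "smin - 3 / 2 * (L * \<eta> * smax\<^sup>2) > 0"
    and le: "real K \<ge> 2 * ((L * \<eta> * smax)\<^sup>2 + (1 + L * \<eta> * smax)\<^sup>2)
      / (\<eta> * (smin - 3 / 2 * (L * \<eta> * smax\<^sup>2))) * ((F x0 - (INF y\<in>carrier_vec d. F y)) / \<epsilon>\<^sup>2)"
  shows "measure_pmf.expectation (pair_pmf P (pmf_of_set {1..K}))
    (\<lambda>(\<xi>, \<zeta>). vnorm (G (x \<xi> \<zeta>))) \<le> \<epsilon>"
proof -
  let ?Q = "pair_pmf P (pmf_of_set {1..K})" and ?D = "F x0 - (INF y\<in>carrier_vec d. F y)"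
  define c where "c = \<eta> * (smin - 3 / 2 * (L * \<eta> * smax\<^sup>2))"
  define b where "b = 2 * ((L * \<eta> * smax)\<^sup>2 + (1 + L * \<eta> * smax)\<^sup>2)"
  define g where "g = (\<lambda>(\<xi>, \<zeta>). vnorm (G (x \<xi> \<zeta>)))"
  have c: "c > 0" using pos \<eta> by (simp add: c_def)
  have b: "b \<ge> 0" by (simp add: b_def)
  have ne: "{1..K} \<noteq> {}" using K by simp
  have fin: "finite (set_pmf ?Q)" using finite_P ne by (simp add: set_pmf_of_set)
  have int: "integrable ?Q h" for h :: "_ \<Rightarrow> real" by (rule integrable_measure_pmf_finite[OF fin])
  have "measure_pmf.expectation ?Q (\<lambda>z. (g z)\<^sup>2)
      = E (\<lambda>\<xi>. (\<Sum>k=1..K. (vnorm (G (x \<xi> k)))\<^sup>2) / real K)"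
    unfolding pair_pmf_def using finite_P ne
    by (simp add: expectation_bind_pmf_finite set_pmf_of_set integral_pmf_of_set g_def)
  also have "\<dots> = (\<Sum>k=1..K. E (\<lambda>\<xi>. (vnorm (G (x \<xi> k)))\<^sup>2)) / real K"
    by simp
  also have "(\<Sum>k=1..K. E (\<lambda>\<xi>. (vnorm (G (x \<xi> k)))\<^sup>2)) = (\<Sum>k<K. E (\<lambda>\<xi>. (vnorm (G (x \<xi> (Suc k))))\<^sup>2))"
    by (rule sum.reindex_bij_witness[of _ Suc "\<lambda>k. k - 1"]) auto
  also have "\<dots> / real K \<le> \<epsilon>\<^sup>2"
  proof -
    have "(\<Sum>k<K. E (\<lambda>\<xi>. (vnorm (G (x \<xi> (Suc k))))\<^sup>2)) \<le> b * (\<Sum>k<K. mean_v k)"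
      using sum_mean_grad_le by (simp add: b_def)
    also have "\<dots> \<le> b * (?D / c)"
      using sum_mean_v_le[OF K bdd] c b by (intro mult_left_mono) (simp_all add: c_def field_simps)
    also have "\<dots> \<le> \<epsilon>\<^sup>2 * real K"
      using mult_right_mono[OF le, of "\<epsilon>\<^sup>2"] \<epsilon>
      unfolding b_def[symmetric] c_def[symmetric] by (simp add: mult.commute)
    finally show ?thesis using K by (simp add: field_simps)
  qed
  finally have "measure_pmf.expectation ?Q (\<lambda>z. (g z)\<^sup>2) \<le> \<epsilon>\<^sup>2" .
  \<comment> \<open>Jensen's inequality for the square, as nonnegativity of the variance.\<close>
  moreover have "(measure_pmf.expectation ?Q g)\<^sup>2 \<le> measure_pmf.expectation ?Q (\<lambda>z. (g z)\<^sup>2)"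
    using measure_pmf.variance_eq[OF int int, of g] measure_pmf.variance_positive[of ?Q g] by simp
  ultimately have "(measure_pmf.expectation ?Q g)\<^sup>2 \<le> \<epsilon>\<^sup>2" by linarith
  then show ?thesis unfolding g_def using \<epsilon> by (auto intro: power2_le_imp_le)
qed

text \<open>Iteration 0 always computes a full gradient, which yields the separate \<open>n\<close>;
  every other cost is charged to the remaining \<open>K - 1\<close> iterations. This leaves no stray
  term in \<open>q\<close> when \<open>K = 1\<close>.\<close>

lemma sfo_calls_le:
  assumes \<xi>: "\<xi> \<in> set_pmf P" and K: "K \<ge> 1"
  shows "real (sfo_calls n q K \<xi>) \<le> real n + (real n / real q + 2 * real q) * (real K - 1)"
proof -
  have K1: "real (K - 1) = real K - 1" using K by simp
  have "sfo_calls n q K \<xi> \<le> (\<Sum>k<K. (if q dvd k then n else 0) + (if k = 0 then 0 else 2 * q))"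
    unfolding sfo_calls_def
  proof (rule sum_mono)
    fix k assume "k \<in> {..<K}"
    then show "(if q dvd k then n else 2 * length (\<xi> k))
        \<le> (if q dvd k then n else 0) + (if k = 0 then 0 else 2 * q)"
      using length_batch_le[OF \<xi>, of k] by (cases "k = 0") auto
  qed
  also have "\<dots> = n * card {k \<in> {..<K}. q dvd k} + 2 * q * (K - 1)"
  proof -
    have "{k \<in> {..<K}. k \<noteq> 0} = {1..<K}" by auto
    then show ?thesis
      by (simp add: sum.distrib sum.inter_filter[symmetric] sum.If_cases Int_def)
  qed
  also have "\<dots> \<le> n * Suc ((K - 1) div q) + 2 * q * (K - 1)"
    using card_multiples_lessThan_le[OF q K] by (intro add_right_mono mult_left_mono) auto
  finally have "real (sfo_calls n q K \<xi>) \<le> real (n * Suc ((K - 1) div q) + 2 * q * (K - 1))"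
    by (rule of_nat_mono)
  also have "\<dots> = real n + real n * real ((K - 1) div q) + 2 * real q * (real K - 1)"
    unfolding of_nat_add of_nat_mult of_nat_Suc K1 by (simp add: algebra_simps)
  also have "\<dots> \<le> real n + real n * (real (K - 1) / real q) + 2 * real q * (real K - 1)"
    by (intro add_mono mult_left_mono of_nat_div_le_of_nat) auto
  finally show ?thesis unfolding K1 by (simp add: algebra_simps)
qed

end

text \<open>Since the square root is at least 1, rounding it either way changes it by at most a
  factor 2.\<close>

lemma rounded_sqrt_bounds:
  assumes "n \<ge> 1" "q \<in> {nat \<lfloor>sqrt (real n)\<rfloor>, nat \<lceil>sqrt (real n)\<rceil>}"
  shows "q \<ge> 1" "sqrt (real n) / 2 \<le> real q" "real q \<le> 2 * sqrt (real n)"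
proof -
  have s: "sqrt (real n) \<ge> 1" using assms(1) by simp
  then have f: "\<lfloor>sqrt (real n)\<rfloor> \<ge> 1" "\<lceil>sqrt (real n)\<rceil> \<ge> 1" by linarith+
  have "real q = of_int \<lfloor>sqrt (real n)\<rfloor> \<or> real q = of_int \<lceil>sqrt (real n)\<rceil>"
    using assms(2) f by auto
  with s f show "sqrt (real n) / 2 \<le> real q" "real q \<le> 2 * sqrt (real n)" by linarith+
  show "q \<ge> 1" using assms(2) f by (elim insertE emptyE) linarith+
qed

theorem theorem1:
  fixes L \<sigma>min \<sigma>max :: real
  assumes "L > 0" and "\<sigma>min > 0" and "\<sigma>max > 0"
  shows "\<exists>C>0. \<forall>(D::real) (B::real). \<exists>C'>0.
    \<forall>(d::nat) (n::nat) (q::nat) (m::nat) (K::nat) (\<delta>::real) (\<gamma>0::real) (\<epsilon>::real)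
     (f :: nat \<Rightarrow> real vec \<Rightarrow> real) (x0 :: real vec) (P :: (nat \<Rightarrow> nat list) pmf)
     (x :: (nat \<Rightarrow> nat list) \<Rightarrow> nat \<Rightarrow> real vec) (v :: (nat \<Rightarrow> nat list) \<Rightarrow> nat \<Rightarrow> real vec)
     (H :: (nat \<Rightarrow> nat list) \<Rightarrow> nat \<Rightarrow> real mat).
      d \<ge> 1 \<longrightarrow> n \<ge> 1 \<longrightarrow> K \<ge> 1 \<longrightarrow> \<delta> > 0 \<longrightarrow> \<gamma>0 > 0 \<longrightarrow> \<epsilon> > 0 \<longrightarrow> x0 \<in> carrier_vec d \<longrightarrow>
      q \<in> {nat \<lfloor>sqrt (real n)\<rfloor>, nat \<lceil>sqrt (real n)\<rceil>} \<longrightarrow>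
      bdd_below (objective n f ` carrier_vec d) \<longrightarrow>
      (\<forall>i\<in>{1..n}. L_smooth d L (f i)) \<longrightarrow>
      (\<forall>i\<in>{1..n}. twice_cont_diff d (f i)) \<longrightarrow>
      (\<exists>\<kappa>>0. \<forall>i\<in>{1..n}. \<forall>y\<in>carrier_vec d. spectral_norm (hessian d (f i) y) \<le> \<kappa>) \<longrightarrow>
      P = batches_pmf n q q K \<longrightarrow>
      (\<forall>\<xi>\<in>set_pmf P. spidersqn_run d n f q (2 * \<sigma>min / ((1 + sqrt 5) * L * \<sigma>max\<^sup>2))
         m \<delta> \<gamma>0 K x0 \<xi> (x \<xi>) (v \<xi>)) \<longrightarrow>
      H = (\<lambda>\<xi>. lbfgs_H d m \<delta> \<gamma>0 (x \<xi>) (v \<xi>)) \<longrightarrow>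
      (\<forall>\<xi>\<in>set_pmf P. \<forall>k<K. loewner_le d (\<sigma>min \<cdot>\<^sub>m 1\<^sub>m d) (H \<xi> k) \<and>
                            loewner_le d (H \<xi> k) (\<sigma>max \<cdot>\<^sub>m 1\<^sub>m d)) \<longrightarrow>
      H_conditionally_determined d K P H v \<longrightarrow>
      D = objective n f x0 - (INF y\<in>carrier_vec d. objective n f y) \<longrightarrow>
      real K \<ge> C * (D / \<epsilon>\<^sup>2) \<longrightarrow>
        measure_pmf.expectation (pair_pmf P (pmf_of_set {1..K}))
          (\<lambda>(\<xi>, \<zeta>). vnorm (grad d (objective n f) (x \<xi> \<zeta>))) \<le> \<epsilon> \<and>
        (real K \<le> B * (D / \<epsilon>\<^sup>2) + 1 \<longrightarrow>
          (\<forall>\<xi>\<in>set_pmf P. real (sfo_calls n q K \<xi>) \<le> C' * (real n + sqrt (real n) / \<epsilon>\<^sup>2)))"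


proof -
  define \<eta> where "\<eta> = 2 * \<sigma>min / ((1 + sqrt 5) * L * \<sigma>max\<^sup>2)"
  have s5: "sqrt 5 > 2" by (rule real_less_rsqrt) simp
  have \<eta>: "\<eta> > 0" using assms s5 by (simp add: \<eta>_def)
  have "L * \<eta> * \<sigma>max\<^sup>2 = 2 * \<sigma>min / (1 + sqrt 5)" using assms by (simp add: \<eta>_def)
  \<comment> \<open>As \<open>sqrt 5 > 2\<close>, the denominator exceeds 3; this is what keeps the
    coefficient with 3/2 positive.\<close>
  also have "\<dots> < 2 / 3 * \<sigma>min" using assms s5 by (simp add: field_simps)
  finally have pos: "\<sigma>min - 3 / 2 * (L * \<eta> * \<sigma>max\<^sup>2) > 0" by simp
  \<comment> \<open>The ratio of the factor in the gradient bound to the factor in the bound on the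
    sum of \<open>mean_v\<close>.\<close>
  define C where "C = 2 * ((L * \<eta> * \<sigma>max)\<^sup>2 + (1 + L * \<eta> * \<sigma>max)\<^sup>2)
    / (\<eta> * (\<sigma>min - 3 / 2 * (L * \<eta> * \<sigma>max\<^sup>2)))"
  have "C > 0"
    using assms \<eta> pos unfolding C_def
    by (intro divide_pos_pos mult_pos_pos add_nonneg_pos zero_less_power) auto
  show ?thesis
  proof (rule exI[of _ C], intro conjI \<open>C > 0\<close> allI)
    fix D B :: real
    show "\<exists>C'>0. \<forall>(d::nat) (n::nat) (q::nat) (m::nat) (K::nat) (\<delta>::real) (\<gamma>0::real) (\<epsilon>::real)
     (f :: nat \<Rightarrow> real vec \<Rightarrow> real) (x0 :: real vec) (P :: (nat \<Rightarrow> nat list) pmf)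
     (x :: (nat \<Rightarrow> nat list) \<Rightarrow> nat \<Rightarrow> real vec) (v :: (nat \<Rightarrow> nat list) \<Rightarrow> nat \<Rightarrow> real vec)
     (H :: (nat \<Rightarrow> nat list) \<Rightarrow> nat \<Rightarrow> real mat).
      d \<ge> 1 \<longrightarrow> n \<ge> 1 \<longrightarrow> K \<ge> 1 \<longrightarrow> \<delta> > 0 \<longrightarrow> \<gamma>0 > 0 \<longrightarrow> \<epsilon> > 0 \<longrightarrow> x0 \<in> carrier_vec d \<longrightarrow>
      q \<in> {nat \<lfloor>sqrt (real n)\<rfloor>, nat \<lceil>sqrt (real n)\<rceil>} \<longrightarrow>
      bdd_below (objective n f ` carrier_vec d) \<longrightarrow>
      (\<forall>i\<in>{1..n}. L_smooth d L (f i)) \<longrightarrow>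
      (\<forall>i\<in>{1..n}. twice_cont_diff d (f i)) \<longrightarrow>
      (\<exists>\<kappa>>0. \<forall>i\<in>{1..n}. \<forall>y\<in>carrier_vec d. spectral_norm (hessian d (f i) y) \<le> \<kappa>) \<longrightarrow>
      P = batches_pmf n q q K \<longrightarrow>
      (\<forall>\<xi>\<in>set_pmf P. spidersqn_run d n f q (2 * \<sigma>min / ((1 + sqrt 5) * L * \<sigma>max\<^sup>2))
         m \<delta> \<gamma>0 K x0 \<xi> (x \<xi>) (v \<xi>)) \<longrightarrow>
      H = (\<lambda>\<xi>. lbfgs_H d m \<delta> \<gamma>0 (x \<xi>) (v \<xi>)) \<longrightarrow>
      (\<forall>\<xi>\<in>set_pmf P. \<forall>k<K. loewner_le d (\<sigma>min \<cdot>\<^sub>m 1\<^sub>m d) (H \<xi> k) \<and>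
                            loewner_le d (H \<xi> k) (\<sigma>max \<cdot>\<^sub>m 1\<^sub>m d)) \<longrightarrow>
      H_conditionally_determined d K P H v \<longrightarrow>
      D = objective n f x0 - (INF y\<in>carrier_vec d. objective n f y) \<longrightarrow>
      real K \<ge> C * (D / \<epsilon>\<^sup>2) \<longrightarrow>
        measure_pmf.expectation (pair_pmf P (pmf_of_set {1..K}))
          (\<lambda>(\<xi>, \<zeta>). vnorm (grad d (objective n f) (x \<xi> \<zeta>))) \<le> \<epsilon> \<and>
        (real K \<le> B * (D / \<epsilon>\<^sup>2) + 1 \<longrightarrow>
          (\<forall>\<xi>\<in>set_pmf P. real (sfo_calls n q K \<xi>) \<le> C' * (real n + sqrt (real n) / \<epsilon>\<^sup>2)))"
    \<comment> \<open>The 6 bounds \<open>n / q + 2 * q\<close> in units of \<open>sqrt n\<close>: 2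
      from the lower bound on \<open>q\<close> and 4 from the upper one. The 1 covers the initial
      full gradient, and the absolute value allows any sign of \<open>B * D\<close>.\<close>
    proof (intro exI[of _ "1 + 6 * \<bar>B * D\<bar>"] conjI allI impI ballI)
      show "1 + 6 * \<bar>B * D\<bar> > 0" by simp
    next
      fix d n q m K :: nat and \<delta> \<gamma>0 \<epsilon> :: real and f :: "nat \<Rightarrow> real vec \<Rightarrow> real" and x0
        and P :: "(nat \<Rightarrow> nat list) pmf" and x v :: "(nat \<Rightarrow> nat list) \<Rightarrow> nat \<Rightarrow> real vec" and H
      assume n: "n \<ge> 1" and K: "K \<ge> 1" and \<epsilon>: "\<epsilon> > 0" and x0: "x0 \<in> carrier_vec d"
        and q: "q \<in> {nat \<lfloor>sqrt (real n)\<rfloor>, nat \<lceil>sqrt (real n)\<rceil>}"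
        and bdd: "bdd_below (objective n f ` carrier_vec d)"
        and smooth: "\<forall>i\<in>{1..n}. L_smooth d L (f i)"
        and P: "P = batches_pmf n q q K"
        and run: "\<forall>\<xi>\<in>set_pmf P. spidersqn_run d n f q (2 * \<sigma>min / ((1 + sqrt 5) * L * \<sigma>max\<^sup>2))
          m \<delta> \<gamma>0 K x0 \<xi> (x \<xi>) (v \<xi>)"
        and H: "H = (\<lambda>\<xi>. lbfgs_H d m \<delta> \<gamma>0 (x \<xi>) (v \<xi>))"
        and bounds: "\<forall>\<xi>\<in>set_pmf P. \<forall>k<K. loewner_le d (\<sigma>min \<cdot>\<^sub>m 1\<^sub>m d) (H \<xi> k) \<and>
          loewner_le d (H \<xi> k) (\<sigma>max \<cdot>\<^sub>m 1\<^sub>m d)"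
        and D: "D = objective n f x0 - (INF y\<in>carrier_vec d. objective n f y)"
        and le: "real K \<ge> C * (D / \<epsilon>\<^sup>2)"
      note qb = rounded_sqrt_bounds[OF n q]
      interpret spidersqn d n q m K L \<eta> \<sigma>min \<sigma>max \<delta> \<gamma>0 f x0 x v
        using n qb(1) assms \<eta> x0 smooth run bounds
        by unfold_locales (auto simp: P H \<eta>_def)
      show "measure_pmf.expectation (pair_pmf P (pmf_of_set {1..K}))
          (\<lambda>(\<xi>, \<zeta>). vnorm (grad d (objective n f) (x \<xi> \<zeta>))) \<le> \<epsilon>"
        unfolding P using le unfolding C_def D by (rule expectation_grad_output_le[OF K bdd \<epsilon> pos])
      fix \<xi> assume KB: "real K \<le> B * (D / \<epsilon>\<^sup>2) + 1" and \<xi>: "\<xi> \<in> set_pmf P"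
      have s: "sqrt (real n) > 0" using n by simp
      have "real n / real q \<le> 2 * sqrt (real n)"
      proof -
        have "real n = sqrt (real n) * sqrt (real n)" by simp
        also have "\<dots> \<le> sqrt (real n) * (2 * real q)" using qb(2) by (intro mult_left_mono) auto
        finally show ?thesis using qb(1) by (simp add: field_simps)
      qed
      then have r: "real n / real q + 2 * real q \<le> 6 * sqrt (real n)" using qb(3) by simp
      have "real (sfo_calls n q K \<xi>) \<le> real n + (real n / real q + 2 * real q) * (real K - 1)"
        using sfo_calls_le[OF _ K] \<xi> by (simp add: P)
      \<comment> \<open>The \<open>+ 1\<close> in the upper bound on \<open>K\<close> matches the
        \<open>K - 1\<close> of the call count; \<open>K \<ge> 1\<close> makes this factor
        nonnegative.\<close>
      also have "\<dots> \<le> real n + 6 * sqrt (real n) * (B * (D / \<epsilon>\<^sup>2))"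
        using r KB K by (intro add_left_mono mult_mono) auto
      also have "\<dots> = real n + 6 * (B * D) * (sqrt (real n) / \<epsilon>\<^sup>2)" by simp
      also have "\<dots> \<le> (1 + 6 * \<bar>B * D\<bar>) * real n + (1 + 6 * \<bar>B * D\<bar>) * (sqrt (real n) / \<epsilon>\<^sup>2)"
        by (intro add_mono mult_right_mono) (auto simp: algebra_simps)
      finally show "real (sfo_calls n q K \<xi>) \<le> (1 + 6 * \<bar>B * D\<bar>) * (real n + sqrt (real n) / \<epsilon>\<^sup>2)"
        by (simp add: algebra_simps)
    qed
  qed
qed

end
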